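(* Let $R$ be a commutative Noetherian ring, let $M$ be a faithful primeful $R$-module, let $X=\mathrm{Spec}(M)$, let $K$ be a submodule of $M$ and set $U=X\setminus V(K)$ and $I=(K:M)$. Then for every $R$-module $N$ there is a unique $R$-isomorphism $f_{K,N}:\mathcal{A}(N,M)(U)\to D_{I}(N)=\varinjlim_n \mathrm{Hom}_R(I^n,N)$ such that $f_{K,N}\circ\epsilon_N^U=\eta_{I,N}$. Moreover, if $h:L\to N$ is a homomorphism of $R$-modules, then $f_{K,N}\circ \mathcal{A}(h,M)(U)=D_{I}(h)\circ f_{K,L}$; hence $f_K:\mathcal{A}(\bullet,M)(U)\to D_{I}(\bullet)$ is a natural equivalence of functors from the category of $R$-modules to itself.
   Context: All rings are commutative with identity, modules unital. For a submodule $L$ of an $R$-module $M$, $(L:M)=\{r\in R\mid rM\subseteq L\}$. A submodule $P$ of $M$ is prime if $P\neq M$ and whenever $rm\in P$ ($r\in R$, $m\in M$) then $r\in (P:M)$ or $m\in P$; then $(P:M)$ is a prime ideal of $R$. $\mathrm{Spec}(M)$ is the set of prime submodules of $M$. $M$ is faithful if $\mathrm{Ann}_R(M)=0$; $M$ is primeful if $M=0$ or the map $\mathrm{Spec}(M)\to\mathrm{Spec}(R/\mathrm{Ann}(M))$, $P\mapsto (P:M)/\mathrm{Ann}(M)$, is surjective. For $L\le M$, $V(L)=\{P\in \mathrm{Spec}(M)\mid (P:M)\supseteq (L:M)\}$; these are the closed sets of the Zariski topology on $X=\mathrm{Spec}(M)$. For $r\in R$, $X_r=X\setminus V(rM)$.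 For open $U\subseteq X$, $\mathrm{Supp}(U)=\{(P:M)\mid P\in U\}$. For an $R$-module $N$, the sheaf $\mathcal{A}(N,M)$ on $X$ is defined by: $\mathcal{A}(N,M)(U)$ is the set of families $(\gamma_{\mathfrak p})_{\mathfrak p\in\mathrm{Supp}(U)}\in\prod_{\mathfrak p\in\mathrm{Supp}(U)}N_{\mathfrak p}$ such that for each $Q\in U$ there exist an open neighbourhood $W\subseteq U$ of $Q$ and $s\in R$, $m\in N$ with $s\notin (P:M)$ and $\gamma_{(P:M)}=m/s\in N_{(P:M)}$ for every $P\in W$ (an $R$-module under componentwise operations; restriction maps restrict families; $\mathcal{A}(N,M)(\emptyset)=0$). The map $\epsilon_N^U:N\to\mathcal{A}(N,M)(U)$ is $n\mapsto (n/1)_{\mathfrak p\in\mathrm{Supp}(U)}$. For an $R$-homomorphism $h:L\to N$, $\mathcal{A}(h,M)(U):\mathcal{A}(L,M)(U)\to\mathcal{A}(N,M)(U)$ sends $(\gamma_{\mathfrak p})$ to $(h_{\mathfrak p}(\gamma_{\mathfrak p}))$, where $h_{\mathfrak p}:L_{\mathfrak p}\to N_{\mathfrak p}$ is the localized map. For an ideal $I$, $D_I(N)=\varinjlim_n\mathrm{Hom}_R(I^n,N)$ is the ideal transform, $D_I(h)$ the induced map, and $\eta_{I,N}:N\to D_I(N)$ is the canonical map sending $n$ to the image of the homomorphism $R\to N$, $r\mapsto rn$. *)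

theory Defs
  imports Complex_Main "HOL-Library.FuncSet"
begin

text \<open>Rings are types of class comm_ring_1; an R-module is a type of class ab_group_add
 together with a scalar multiplication sc satisfying the axioms of the locale module
 (HOL/Modules.thy).  The module M is the whole type (its carrier is UNIV);
 submodules are the sets S with module.subspace sc S.\<close>

definition ideal_r :: "'r::comm_ring_1 set \<Rightarrow> bool" where
  "ideal_r I \<longleftrightarrow> module.subspace ((*) :: 'r \<Rightarrow> 'r \<Rightarrow> 'r) I"

definition prime_ideal_r :: "'r::comm_ring_1 set \<Rightarrow> bool" where
  "prime_ideal_r p \<longleftrightarrow> ideal_r p \<and> p \<noteq> UNIV \<and> (\<forall>a b. a * b \<in> p \<longrightarrow> a \<in> p \<or> b \<in> p)"

definition noetherian_ring :: "'r::comm_ring_1 itself \<Rightarrow> bool" where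
  "noetherian_ring _ \<longleftrightarrow>
     (\<forall>I::'r set. ideal_r I \<longrightarrow> (\<exists>S. finite S \<and> I = module.span ((*) :: 'r \<Rightarrow> 'r \<Rightarrow> 'r) S))"

fun ideal_pow :: "'r::comm_ring_1 set \<Rightarrow> nat \<Rightarrow> 'r set" where
  "ideal_pow I 0 = UNIV"
| "ideal_pow I (Suc k) = module.span ((*) :: 'r \<Rightarrow> 'r \<Rightarrow> 'r) {a * b | a b. a \<in> ideal_pow I k \<and> b \<in> I}"

definition colon :: "('r::comm_ring_1 \<Rightarrow> 'm::ab_group_add \<Rightarrow> 'm) \<Rightarrow> 'm set \<Rightarrow> 'r set" where
  "colon sc L = {r. \<forall>m. sc r m \<in> L}"

definition Ann :: "('r::comm_ring_1 \<Rightarrow> 'm::ab_group_add \<Rightarrow> 'm) \<Rightarrow> 'r set" where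
  "Ann sc = {r. \<forall>m. sc r m = 0}"

definition faithful :: "('r::comm_ring_1 \<Rightarrow> 'm::ab_group_add \<Rightarrow> 'm) \<Rightarrow> bool" where
  "faithful sc \<longleftrightarrow> Ann sc = {0}"

definition prime_submodule :: "('r::comm_ring_1 \<Rightarrow> 'm::ab_group_add \<Rightarrow> 'm) \<Rightarrow> 'm set \<Rightarrow> bool" where
  "prime_submodule sc P \<longleftrightarrow> module.subspace sc P \<and> P \<noteq> UNIV \<and>
     (\<forall>r m. sc r m \<in> P \<longrightarrow> r \<in> colon sc P \<or> m \<in> P)"

definition SpecM :: "('r::comm_ring_1 \<Rightarrow> 'm::ab_group_add \<Rightarrow> 'm) \<Rightarrow> 'm set set" where
  "SpecM sc = {P. prime_submodule sc P}"

text \<open>Spec(R/Ann(M)) is identified with the prime ideals of R containing Ann(M), the map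
 P |-> (P:M)/Ann(M) then corresponding to P |-> (P:M).\<close>
definition primeful :: "('r::comm_ring_1 \<Rightarrow> 'm::ab_group_add \<Rightarrow> 'm) \<Rightarrow> bool" where
  "primeful sc \<longleftrightarrow> (UNIV :: 'm set) = {0} \<or>
     (\<forall>p. prime_ideal_r p \<and> Ann sc \<subseteq> p \<longrightarrow> (\<exists>P\<in>SpecM sc. colon sc P = p))"

definition VM :: "('r::comm_ring_1 \<Rightarrow> 'm::ab_group_add \<Rightarrow> 'm) \<Rightarrow> 'm set \<Rightarrow> 'm set set" where
  "VM sc L = {P \<in> SpecM sc. colon sc L \<subseteq> colon sc P}"

definition zariski_open :: "('r::comm_ring_1 \<Rightarrow> 'm::ab_group_add \<Rightarrow> 'm) \<Rightarrow> 'm set set \<Rightarrow> bool" where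
  "zariski_open sc W \<longleftrightarrow> (\<exists>L. module.subspace sc L \<and> W = SpecM sc - VM sc L)"

definition Supp :: "('r::comm_ring_1 \<Rightarrow> 'm::ab_group_add \<Rightarrow> 'm) \<Rightarrow> 'm set set \<Rightarrow> 'r set set" where
  "Supp sc U = (colon sc) ` U"

definition loc_rel :: "('r::comm_ring_1 \<Rightarrow> 'n::ab_group_add \<Rightarrow> 'n) \<Rightarrow> 'r set \<Rightarrow> (('n \<times> 'r) \<times> ('n \<times> 'r)) set" where
  "loc_rel sc p = {((n, s), (n', s')). s \<notin> p \<and> s' \<notin> p \<and>
      (\<exists>u. u \<notin> p \<and> sc u (sc s' n - sc s n') = 0)}"

definition frac :: "('r::comm_ring_1 \<Rightarrow> 'n::ab_group_add \<Rightarrow> 'n) \<Rightarrow> 'r set \<Rightarrow> 'n \<Rightarrow> 'r \<Rightarrow> ('n \<times> 'r) set" where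
  "frac sc p n s = loc_rel sc p `` {(n, s)}"

definition localization :: "('r::comm_ring_1 \<Rightarrow> 'n::ab_group_add \<Rightarrow> 'n) \<Rightarrow> 'r set \<Rightarrow> ('n \<times> 'r) set set" where
  "localization sc p = {frac sc p n s | n s. s \<notin> p}"

definition loc_add :: "('r::comm_ring_1 \<Rightarrow> 'n::ab_group_add \<Rightarrow> 'n) \<Rightarrow> 'r set \<Rightarrow>
    ('n \<times> 'r) set \<Rightarrow> ('n \<times> 'r) set \<Rightarrow> ('n \<times> 'r) set" where
  "loc_add sc p x y = (let (n, s) = (SOME q. q \<in> x); (n', s') = (SOME q. q \<in> y)
      in frac sc p (sc s' n + sc s n') (s * s'))"

definition loc_scale :: "('r::comm_ring_1 \<Rightarrow> 'n::ab_group_add \<Rightarrow> 'n) \<Rightarrow> 'r set \<Rightarrow>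
    'r \<Rightarrow> ('n \<times> 'r) set \<Rightarrow> ('n \<times> 'r) set" where
  "loc_scale sc p r x = (let (n, s) = (SOME q. q \<in> x) in frac sc p (sc r n) s)"

definition loc_map :: "('r::comm_ring_1 \<Rightarrow> 'n::ab_group_add \<Rightarrow> 'n) \<Rightarrow> 'r set \<Rightarrow>
    ('l \<Rightarrow> 'n) \<Rightarrow> ('l \<times> 'r) set \<Rightarrow> ('n \<times> 'r) set" where
  "loc_map scN p h x = (let (l, s) = (SOME q. q \<in> x) in frac scN p (h l) s)"

type_synonym ('r, 'n) sect = "'r set \<Rightarrow> ('n \<times> 'r) set"

definition sheafA :: "('r::comm_ring_1 \<Rightarrow> 'n::ab_group_add \<Rightarrow> 'n) \<Rightarrow>
    ('r \<Rightarrow> 'm::ab_group_add \<Rightarrow> 'm) \<Rightarrow> 'm set set \<Rightarrow> ('r, 'n) sect set" where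
  "sheafA scN scM U = {\<gamma>. \<gamma> \<in> extensional (Supp scM U) \<and>
     (\<forall>p\<in>Supp scM U. \<gamma> p \<in> localization scN p) \<and>
     (\<forall>Q\<in>U. \<exists>W. zariski_open scM W \<and> Q \<in> W \<and> W \<subseteq> U \<and>
        (\<exists>s m. \<forall>P\<in>W. s \<notin> colon scM P \<and> \<gamma> (colon scM P) = frac scN (colon scM P) m s))}"

definition sheafA_add :: "('r::comm_ring_1 \<Rightarrow> 'n::ab_group_add \<Rightarrow> 'n) \<Rightarrow>
    ('r \<Rightarrow> 'm::ab_group_add \<Rightarrow> 'm) \<Rightarrow> 'm set set \<Rightarrow>
    ('r, 'n) sect \<Rightarrow> ('r, 'n) sect \<Rightarrow> ('r, 'n) sect" where
  "sheafA_add scN scM U \<gamma> \<delta> = (\<lambda>p\<in>Supp scM U. loc_add scN p (\<gamma> p) (\<delta> p))"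

definition sheafA_scale :: "('r::comm_ring_1 \<Rightarrow> 'n::ab_group_add \<Rightarrow> 'n) \<Rightarrow>
    ('r \<Rightarrow> 'm::ab_group_add \<Rightarrow> 'm) \<Rightarrow> 'm set set \<Rightarrow>
    'r \<Rightarrow> ('r, 'n) sect \<Rightarrow> ('r, 'n) sect" where
  "sheafA_scale scN scM U r \<gamma> = (\<lambda>p\<in>Supp scM U. loc_scale scN p r (\<gamma> p))"

definition epsilonA :: "('r::comm_ring_1 \<Rightarrow> 'n::ab_group_add \<Rightarrow> 'n) \<Rightarrow>
    ('r \<Rightarrow> 'm::ab_group_add \<Rightarrow> 'm) \<Rightarrow> 'm set set \<Rightarrow> 'n \<Rightarrow> ('r, 'n) sect" where
  "epsilonA scN scM U n = (\<lambda>p\<in>Supp scM U. frac scN p n 1)"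

definition sheafA_map :: "('r::comm_ring_1 \<Rightarrow> 'n::ab_group_add \<Rightarrow> 'n) \<Rightarrow>
    ('r \<Rightarrow> 'm::ab_group_add \<Rightarrow> 'm) \<Rightarrow> 'm set set \<Rightarrow> ('l \<Rightarrow> 'n) \<Rightarrow>
    ('r, 'l) sect \<Rightarrow> ('r, 'n) sect" where
  "sheafA_map scN scM U h \<gamma> = (\<lambda>p\<in>Supp scM U. loc_map scN p h (\<gamma> p))"

definition HomI :: "('r::comm_ring_1 \<Rightarrow> 'n::ab_group_add \<Rightarrow> 'n) \<Rightarrow> 'r set \<Rightarrow> ('r \<Rightarrow> 'n) set" where
  "HomI sc J = {\<phi>. \<phi> \<in> extensional J \<and>
     (\<forall>x\<in>J. \<forall>y\<in>J. \<phi> (x + y) = \<phi> x + \<phi> y) \<and> (\<forall>r. \<forall>x\<in>J. \<phi> (r * x) = sc r (\<phi> x))}"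

text \<open>Direct limit along the restriction maps Hom(I^n,N) -> Hom(I^(n+1),N):
 (n,phi) ~ (n',phi') iff they agree on some I^k with k >= n, n'.\<close>
definition dl_rel :: "('r::comm_ring_1 \<Rightarrow> 'n::ab_group_add \<Rightarrow> 'n) \<Rightarrow> 'r set \<Rightarrow>
    ((nat \<times> ('r \<Rightarrow> 'n)) \<times> (nat \<times> ('r \<Rightarrow> 'n))) set" where
  "dl_rel sc I = {((n, \<phi>), (n', \<phi>')). \<phi> \<in> HomI sc (ideal_pow I n) \<and> \<phi>' \<in> HomI sc (ideal_pow I n') \<and>
      (\<exists>k. n \<le> k \<and> n' \<le> k \<and> (\<forall>x\<in>ideal_pow I k. \<phi> x = \<phi>' x))}"

definition dl_class :: "('r::comm_ring_1 \<Rightarrow> 'n::ab_group_add \<Rightarrow> 'n) \<Rightarrow> 'r set \<Rightarrow>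
    nat \<Rightarrow> ('r \<Rightarrow> 'n) \<Rightarrow> (nat \<times> ('r \<Rightarrow> 'n)) set" where
  "dl_class sc I n \<phi> = dl_rel sc I `` {(n, \<phi>)}"

definition transformD :: "('r::comm_ring_1 \<Rightarrow> 'n::ab_group_add \<Rightarrow> 'n) \<Rightarrow> 'r set \<Rightarrow>
    (nat \<times> ('r \<Rightarrow> 'n)) set set" where
  "transformD sc I = {dl_class sc I n \<phi> | n \<phi>. \<phi> \<in> HomI sc (ideal_pow I n)}"

definition transformD_add :: "('r::comm_ring_1 \<Rightarrow> 'n::ab_group_add \<Rightarrow> 'n) \<Rightarrow> 'r set \<Rightarrow>
    (nat \<times> ('r \<Rightarrow> 'n)) set \<Rightarrow> (nat \<times> ('r \<Rightarrow> 'n)) set \<Rightarrow> (nat \<times> ('r \<Rightarrow> 'n)) set" where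
  "transformD_add sc I x y = (let (n, \<phi>) = (SOME q. q \<in> x); (n', \<phi>') = (SOME q. q \<in> y);
      k = max n n' in dl_class sc I k (\<lambda>a\<in>ideal_pow I k. \<phi> a + \<phi>' a))"

definition transformD_scale :: "('r::comm_ring_1 \<Rightarrow> 'n::ab_group_add \<Rightarrow> 'n) \<Rightarrow> 'r set \<Rightarrow>
    'r \<Rightarrow> (nat \<times> ('r \<Rightarrow> 'n)) set \<Rightarrow> (nat \<times> ('r \<Rightarrow> 'n)) set" where
  "transformD_scale sc I r x = (let (n, \<phi>) = (SOME q. q \<in> x)
      in dl_class sc I n (\<lambda>a\<in>ideal_pow I n. sc r (\<phi> a)))"

definition etaD :: "('r::comm_ring_1 \<Rightarrow> 'n::ab_group_add \<Rightarrow> 'n) \<Rightarrow> 'r set \<Rightarrow>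
    'n \<Rightarrow> (nat \<times> ('r \<Rightarrow> 'n)) set" where
  "etaD sc I n = dl_class sc I 0 (\<lambda>r. sc r n)"

definition transformD_map :: "('r::comm_ring_1 \<Rightarrow> 'n::ab_group_add \<Rightarrow> 'n) \<Rightarrow> 'r set \<Rightarrow>
    ('l \<Rightarrow> 'n) \<Rightarrow> (nat \<times> ('r \<Rightarrow> 'l)) set \<Rightarrow> (nat \<times> ('r \<Rightarrow> 'n)) set" where
  "transformD_map scN I h x = (let (n, \<phi>) = (SOME q. q \<in> x)
      in dl_class scN I n (\<lambda>a\<in>ideal_pow I n. h (\<phi> a)))"

definition is_fKN :: "('r::comm_ring_1 \<Rightarrow> 'n::ab_group_add \<Rightarrow> 'n) \<Rightarrow>
    ('r \<Rightarrow> 'm::ab_group_add \<Rightarrow> 'm) \<Rightarrow> 'm set \<Rightarrow>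
    (('r, 'n) sect \<Rightarrow> (nat \<times> ('r \<Rightarrow> 'n)) set) \<Rightarrow> bool" where
  "is_fKN scN scM K f \<longleftrightarrow>
    (let U = SpecM scM - VM scM K; I = colon scM K; A = sheafA scN scM U in
      f \<in> extensional A \<and>
      bij_betw f A (transformD scN I) \<and>
      (\<forall>\<gamma>\<in>A. \<forall>\<delta>\<in>A. f (sheafA_add scN scM U \<gamma> \<delta>) = transformD_add scN I (f \<gamma>) (f \<delta>)) \<and>
      (\<forall>r. \<forall>\<gamma>\<in>A. f (sheafA_scale scN scM U r \<gamma>) = transformD_scale scN I r (f \<gamma>)) \<and>
      (\<forall>n. f (epsilonA scN scM U n) = etaD scN I n))"

end

theory Submission
  imports Defs
begin

text \<open>Since \<open>M\<close> is faithful and primeful, \<open>Supp(U)\<close> is the set of all primes not containing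
  \<open>I\<close>, and the sheaf condition can be tested on basic open sets \<open>D(c)\<close> of \<open>Spec(R)\<close>.
  The inverse of \<open>f\<close> sends the class of \<open>\<phi> : I^n \<rightarrow> N\<close> to the family \<open>\<phi>(a)/a\<close>, where \<open>a\<close> is any element
  of \<open>I^n\<close> outside \<open>p\<close>. For surjectivity one extends a homomorphism \<open>\<psi> : b \<rightarrow> N\<close> with
  \<open>\<psi>(x)/1 = x \<gamma>\<close> to larger and larger ideals \<open>b\<close>, until \<open>b\<close> contains a power of \<open>I\<close>; Noetherian
  induction replaces both finite covers and the Artin-Rees lemma. Uniqueness holds because every
  \<open>\<gamma>\<close> is determined by those multiples \<open>x \<gamma>\<close> that lie in the image of \<open>N\<close>, and naturality
  because it is clear for the inverse.\<close>

subsection \<open>Ideals of a Noetherian ring\<close>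

lemma ring_module: "module ((*) :: 'r::comm_ring_1 \<Rightarrow> 'r \<Rightarrow> 'r)"
  by unfold_locales (auto simp: algebra_simps)

lemma ideal_rI:
  assumes "0 \<in> I" and "\<And>x y. x \<in> I \<Longrightarrow> y \<in> I \<Longrightarrow> x + y \<in> I" and "\<And>c x. x \<in> I \<Longrightarrow> c * x \<in> I"
  shows "ideal_r I"
  using assms unfolding ideal_r_def module.subspace_def[OF ring_module] by blast

lemma ideal_r_zero: "ideal_r I \<Longrightarrow> 0 \<in> I"
  and ideal_r_add: "ideal_r I \<Longrightarrow> x \<in> I \<Longrightarrow> y \<in> I \<Longrightarrow> x + y \<in> I"
  and ideal_r_mult: "ideal_r I \<Longrightarrow> x \<in> I \<Longrightarrow> c * x \<in> I"
  unfolding ideal_r_def module.subspace_def[OF ring_module] by blast+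

lemma ideal_r_mult_right: "ideal_r I \<Longrightarrow> x \<in> I \<Longrightarrow> x * c \<in> I"
  using ideal_r_mult[of I x c] by (simp add: mult.commute)

lemma ideal_r_UNIV: "ideal_r UNIV" and ideal_r_singleton_0: "ideal_r {0}"
  by (auto intro: ideal_rI)

text \<open>The ideal \<open>J + (x)\<close>. The explicit form \<open>a + r * x\<close> is the one
  on which \<open>partial_hom_extend\<close> prescribes values.\<close>

definition add_principal :: "'r::comm_ring_1 set \<Rightarrow> 'r \<Rightarrow> 'r set" where
  "add_principal J x = {a + r * x |a r. a \<in> J}"

lemma add_principalI: "a \<in> J \<Longrightarrow> a + r * x \<in> add_principal J x"
  unfolding add_principal_def by blast

lemma add_principalE:
  assumes "z \<in> add_principal J x"
  obtains a r where "z = a + r * x" "a \<in> J"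
  using assms unfolding add_principal_def by blast

lemma ideal_r_add_principal:
  assumes "ideal_r J"
  shows "ideal_r (add_principal J x)"
proof (rule ideal_rI)
  show "0 \<in> add_principal J x"
    using add_principalI[OF ideal_r_zero[OF assms], of 0] by simp
next
  fix u v assume "u \<in> add_principal J x" "v \<in> add_principal J x"
  then obtain a r b s where "u = a + r * x" "v = b + s * x" "a \<in> J" "b \<in> J"
    by (auto elim!: add_principalE)
  then have "u + v = (a + b) + (r + s) * x" "a + b \<in> J"
    using ideal_r_add[OF assms] by (auto simp: algebra_simps)
  then show "u + v \<in> add_principal J x" by (simp only: add_principalI)
next
  fix c u assume "u \<in> add_principal J x"
  then obtain a r where "u = a + r * x" "a \<in> J" by (rule add_principalE)
  then have "c * u = c * a + (c * r) * x" "c * a \<in> J"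
    using ideal_r_mult[OF assms] by (auto simp: algebra_simps)
  then show "c * u \<in> add_principal J x" by (simp only: add_principalI)
qed

lemma subset_add_principal: "J \<subseteq> add_principal J x"
  using add_principalI[of _ J 0 x] by auto

lemma mem_add_principal: "ideal_r J \<Longrightarrow> x \<in> add_principal J x"
  using add_principalI[of 0 J 1 x] ideal_r_zero[of J] by simp

section \<open>Powers of an ideal\<close>

lemma ideal_pow_ideal: "ideal_r (ideal_pow I n)"
  by (cases n) (simp_all add: ideal_r_UNIV, simp add: ideal_r_def module.subspace_span[OF ring_module])

lemma ideal_pow_mult: "a \<in> ideal_pow I n \<Longrightarrow> b \<in> I \<Longrightarrow> a * b \<in> ideal_pow I (Suc n)"
  by (auto intro!: module.span_base[OF ring_module])

lemma ideal_pow_power: "c \<in> I \<Longrightarrow> c ^ n \<in> ideal_pow I n"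
proof (induction n)
  case (Suc n)
  then show ?case using ideal_pow_mult[of "c ^ n" I n c] by (simp only: power_Suc2)
qed simp

lemma ideal_pow_Suc_subsetI:
  assumes "ideal_r J" and "\<And>a b. a \<in> ideal_pow I n \<Longrightarrow> b \<in> I \<Longrightarrow> a * b \<in> J"
  shows "ideal_pow I (Suc n) \<subseteq> J"
  unfolding ideal_pow.simps
  by (rule module.span_minimal[OF ring_module]) (use assms in \<open>auto simp: ideal_r_def\<close>)

lemma ideal_pow_antimono: "n \<le> k \<Longrightarrow> ideal_pow I k \<subseteq> ideal_pow I n"
proof (induction rule: dec_induct)
  case (step k)
  have "ideal_pow I (Suc k) \<subseteq> ideal_pow I k"
    by (rule ideal_pow_Suc_subsetI) (auto intro: ideal_pow_ideal ideal_r_mult_right)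
  with step show ?case by blast
qed simp

text \<open>Since \<open>ideal_pow\<close> multiplies by one copy of \<open>I\<close> at a time,
  splitting I^(n+m) into I^n I^m needs an induction on \<open>m\<close>. Stating it for every ideal
  \<open>J\<close> that contains the products makes the induction go through.\<close>

lemma ideal_pow_add_subset:
  assumes "ideal_r J" and "\<And>u v. u \<in> ideal_pow I n \<Longrightarrow> v \<in> ideal_pow I m \<Longrightarrow> u * v \<in> J"
  shows "ideal_pow I (n + m) \<subseteq> J"
  using assms
proof (induction m arbitrary: J)
  case 0
  from "0"(2)[where v = 1] show ?case by auto
next
  case (Suc m)
  \<comment> \<open>The colon ideal (J : I). It contains the products of I^n and I^m because
    \<open>v * b\<close> lies in I^(m+1), so the induction hypothesis applies to it.\<close>
  define J' where "J' = {z. \<forall>b\<in>I. z * b \<in> J}"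
  have "ideal_r J'"
  proof (rule ideal_rI)
    show "0 \<in> J'" using ideal_r_zero[OF Suc.prems(1)] by (simp add: J'_def)
    show "x + y \<in> J'" if "x \<in> J'" "y \<in> J'" for x y
      using that ideal_r_add[OF Suc.prems(1)] by (simp add: J'_def distrib_right)
    show "c * x \<in> J'" if "x \<in> J'" for c x
      using that ideal_r_mult[OF Suc.prems(1)] by (simp add: J'_def mult.assoc)
  qed
  moreover have "u * v \<in> J'" if "u \<in> ideal_pow I n" "v \<in> ideal_pow I m" for u v
    unfolding J'_def using that Suc.prems(2) ideal_pow_mult[of v I m] by (auto simp: mult.assoc)
  ultimately have "ideal_pow I (n + m) \<subseteq> J'" by (rule Suc.IH)
  then have "ideal_pow I (Suc (n + m)) \<subseteq> J"
    by (intro ideal_pow_Suc_subsetI Suc.prems(1)) (auto simp: J'_def)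
  then show ?case by simp
qed

text \<open>If \<open>c\<close> in \<open>I\<close> lies outside \<open>p\<close>, then so does
  \<open>c ^ n\<close>, which is an element of I^n.\<close>

lemma ideal_pow_not_subset_prime:
  assumes "prime_ideal_r p" "\<not> I \<subseteq> p"
  shows "\<exists>a. a \<in> ideal_pow I n \<and> a \<notin> p"
proof -
  obtain c where "c \<in> I" "c \<notin> p" using assms by blast
  moreover have "c ^ n \<notin> p"
  proof (induction n)
    case 0
    have "ideal_r p" "p \<noteq> UNIV" using assms by (auto simp: prime_ideal_r_def)
    then show ?case using ideal_r_mult[of p 1] by auto
  next
    case (Suc n)
    then show ?case using assms(1) \<open>c \<notin> p\<close> by (auto simp: prime_ideal_r_def)
  qed
  ultimately show ?thesis using ideal_pow_power by blast
qed

text \<open>Zorn's lemma applies because the union of a chain is a finitely generated ideal: the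
  generators all lie in one member of the chain, so the union equals that member and inherits
  \<open>P\<close>.\<close>

lemma noetherian_maximal_ideal:
  assumes "noetherian_ring TYPE('r::comm_ring_1)" and "ideal_r b0" and "P b0"
  shows "\<exists>b::'r set. ideal_r b \<and> P b \<and> (\<forall>b'. ideal_r b' \<and> P b' \<and> b \<subseteq> b' \<longrightarrow> b' = b)"
proof -
  let ?A = "{b. ideal_r b \<and> P b}"
  have "\<exists>M\<in>?A. \<forall>X\<in>?A. M \<subseteq> X \<longrightarrow> X = M"
  proof (rule subset_Zorn_nonempty)
    show "?A \<noteq> {}" using assms by blast
  next
    fix C assume C: "C \<noteq> {}" "subset.chain ?A C"
    have CA: "C \<subseteq> ?A" and lin: "\<And>x y. x \<in> C \<Longrightarrow> y \<in> C \<Longrightarrow> x \<subseteq> y \<or> y \<subseteq> x"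
      using C(2) unfolding subset_chain_def by blast+
    have "ideal_r (\<Union>C)"
    proof (rule ideal_rI)
      show "0 \<in> \<Union>C" using C(1) CA ideal_r_zero by blast
      fix x assume x: "x \<in> \<Union>C"
      show "c * x \<in> \<Union>C" for c using x CA ideal_r_mult by blast
      fix y assume "y \<in> \<Union>C"
      with x obtain X Y where "X \<in> C" "Y \<in> C" "x \<in> X" "y \<in> Y" by blast
      then obtain Z where "Z \<in> C" "x \<in> Z" "y \<in> Z" using lin by blast
      then show "x + y \<in> \<Union>C" using CA ideal_r_add by blast
    qed
    then obtain S where S: "finite S" "\<Union>C = module.span (*) S"
      using assms(1) unfolding noetherian_ring_def by blast
    have "S \<subseteq> \<Union>C" using S(2) module.span_superset[OF ring_module] by blast
    then obtain B where B: "B \<in> C" "S \<subseteq> B"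
      using finite_subset_Union_chain[OF S(1) _ C] by blast
    have "\<Union>C \<subseteq> B" unfolding S(2)
      using B CA by (intro module.span_minimal[OF ring_module]) (auto simp: ideal_r_def)
    with B have "\<Union>C = B" by blast
    with B CA show "\<Union>C \<in> ?A" by blast
  qed
  then show ?thesis by blast
qed

text \<open>An ideal maximal among those that contain \<open>J\<close> but no power of
  \<open>I\<close> is prime. By hypothesis it then contains \<open>I\<close>, a
  contradiction.\<close>

lemma ideal_pow_subset_if_primes:
  fixes I J :: "'r::comm_ring_1 set"
  assumes noeth: "noetherian_ring TYPE('r)" and I: "ideal_r I" and J: "ideal_r J"
    and primes: "\<And>p. prime_ideal_r p \<Longrightarrow> J \<subseteq> p \<Longrightarrow> I \<subseteq> p"
  shows "\<exists>n. ideal_pow I n \<subseteq> J"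
proof (rule ccontr)
  assume neg: "\<nexists>n. ideal_pow I n \<subseteq> J"
  define bad where "bad b \<longleftrightarrow> J \<subseteq> b \<and> (\<nexists>n. ideal_pow I n \<subseteq> b)" for b
  have "bad J" using neg by (simp add: bad_def)
  then obtain p where p: "ideal_r p" "bad p"
    and max: "\<And>b. ideal_r b \<Longrightarrow> bad b \<Longrightarrow> p \<subseteq> b \<Longrightarrow> b = p"
    using noetherian_maximal_ideal[of J bad, OF noeth J] by blast
  have Jp: "J \<subseteq> p" and none: "\<And>n. \<not> ideal_pow I n \<subseteq> p"
    using p(2) by (simp_all add: bad_def)
  have "prime_ideal_r p"
    unfolding prime_ideal_r_def
  proof (intro conjI allI impI)
    show "p \<noteq> UNIV" using none[of 0] by auto
    fix x y assume xy: "x * y \<in> p"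
    show "x \<in> p \<or> y \<in> p"
    proof (rule ccontr)
      assume notin: "\<not> (x \<in> p \<or> y \<in> p)"
      have "\<exists>n. ideal_pow I n \<subseteq> add_principal p z" if "z \<notin> p" for z
      proof (rule ccontr)
        assume "\<nexists>n. ideal_pow I n \<subseteq> add_principal p z"
        then have "add_principal p z = p"
          using max[OF ideal_r_add_principal[OF p(1)] _ subset_add_principal]
            subset_trans[OF Jp subset_add_principal] by (simp add: bad_def)
        with mem_add_principal[OF p(1), of z] that show False by simp
      qed
      then obtain n m where nm: "ideal_pow I n \<subseteq> add_principal p x" "ideal_pow I m \<subseteq> add_principal p y"
        using notin by blast
      have "ideal_pow I (n + m) \<subseteq> p"
      proof (rule ideal_pow_add_subset[OF p(1)])
        fix u v assume "u \<in> ideal_pow I n" "v \<in> ideal_pow I m"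
        with nm obtain a r b s where u: "u = a + r * x" "a \<in> p" and v: "v = b + s * y" "b \<in> p"
          by (metis add_principalE subsetD)
        \<comment> \<open>Each summand has a factor in \<open>p\<close>: \<open>a\<close>,
          \<open>b\<close> or \<open>x * y\<close>.\<close>
        have "u * v = v * a + ((r * x) * b + (r * s) * (x * y))"
          unfolding u(1) v(1) by (simp add: algebra_simps)
        moreover have "v * a + ((r * x) * b + (r * s) * (x * y)) \<in> p"
          by (intro ideal_r_add[OF p(1)] ideal_r_mult[OF p(1)] u(2) v(2) xy)
        ultimately show "u * v \<in> p" by (simp only:)
      qed
      with none show False by blast
    qed
  qed (rule p(1))
  then have "I \<subseteq> p" using primes Jp by blast
  moreover have "ideal_pow I (Suc 0) \<subseteq> I"
    by (rule ideal_pow_Suc_subsetI) (auto intro: I ideal_r_mult)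
  ultimately show False using none by blast
qed

text \<open>The preceding lemma for the principal ideal (a). Applied to annihilators, it turns an
  equality of fractions at all primes missing \<open>a\<close> into annihilation by a power of
  \<open>a\<close>.\<close>

lemma power_mem_if_primes:
  fixes J :: "'r::comm_ring_1 set"
  assumes noeth: "noetherian_ring TYPE('r)" and J: "ideal_r J"
    and primes: "\<And>p. prime_ideal_r p \<Longrightarrow> J \<subseteq> p \<Longrightarrow> a \<in> p"
  shows "\<exists>n. a ^ n \<in> J"
proof -
  let ?I = "add_principal {0} a"
  have "ideal_r ?I" by (rule ideal_r_add_principal[OF ideal_r_singleton_0])
  moreover have "?I \<subseteq> p" if "prime_ideal_r p" "J \<subseteq> p" for p
    using primes[OF that] that by (auto simp: prime_ideal_r_def ideal_r_mult elim!: add_principalE)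
  ultimately obtain n where "ideal_pow ?I n \<subseteq> J"
    using ideal_pow_subset_if_primes[OF noeth _ J] by blast
  moreover have "a \<in> ?I" by (rule mem_add_principal[OF ideal_r_singleton_0])
  ultimately show ?thesis using ideal_pow_power by blast
qed

text \<open>Reading \<open>P b\<close> as a property of the open set \<open>D(b)\<close>, this replaces finite subcovers of
  the complement of \<open>V(I)\<close>.\<close>
lemma noetherian_cover_induct:
  fixes I :: "'r::comm_ring_1 set"
  assumes noeth: "noetherian_ring TYPE('r)" and I: "ideal_r I"
    and base: "P {0}"
    and step: "\<And>b p. ideal_r b \<Longrightarrow> P b \<Longrightarrow> prime_ideal_r p \<Longrightarrow> \<not> I \<subseteq> p \<Longrightarrow> b \<subseteq> p \<Longrightarrow>
      \<exists>x. x \<notin> p \<and> P (add_principal b x)"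
  shows "\<exists>b n. ideal_r b \<and> P b \<and> ideal_pow I n \<subseteq> b"
proof -
  obtain b where b: "ideal_r b" "P b" and max: "\<And>b'. ideal_r b' \<Longrightarrow> P b' \<Longrightarrow> b \<subseteq> b' \<Longrightarrow> b' = b"
    using noetherian_maximal_ideal[of "{0}" P, OF noeth ideal_r_singleton_0 base] by blast
  \<comment> \<open>By maximality of \<open>b\<close>, the hypothesis \<open>step\<close> leaves no
    prime that contains \<open>b\<close> but not \<open>I\<close>.\<close>
  have "I \<subseteq> p" if p: "prime_ideal_r p" "b \<subseteq> p" for p
  proof (rule ccontr)
    assume "\<not> I \<subseteq> p"
    then obtain x where "x \<notin> p" "P (add_principal b x)" using step[OF b p(1) _ p(2)] by blast
    moreover from this(2) have "add_principal b x = b"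
      using max[OF ideal_r_add_principal[OF b(1)] _ subset_add_principal] by blast
    ultimately show False using mem_add_principal[OF b(1), of x] p(2) by blast
  qed
  with ideal_pow_subset_if_primes[OF noeth I b(1)] b show ?thesis by blast
qed

subsection \<open>Fractions\<close>

lemma prime_ideal_one: "prime_ideal_r p \<Longrightarrow> 1 \<notin> p"
  unfolding prime_ideal_r_def using ideal_r_mult[of p 1] by auto

lemma prime_ideal_mult: "prime_ideal_r p \<Longrightarrow> a * b \<in> p \<longleftrightarrow> a \<in> p \<or> b \<in> p"
  unfolding prime_ideal_r_def using ideal_r_mult ideal_r_mult_right by blast

lemma prime_ideal_power: "prime_ideal_r p \<Longrightarrow> a ^ n \<in> p \<Longrightarrow> a \<in> p"
  by (induction n) (auto simp: prime_ideal_mult prime_ideal_one)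

context module
begin

lemma loc_rel_equiv:
  assumes "prime_ideal_r p"
  shows "equiv {(n, s). s \<notin> p} (loc_rel scale p)"
proof (rule equivI)
  show "loc_rel scale p \<subseteq> {(n, s). s \<notin> p} \<times> {(n, s). s \<notin> p}"
    by (auto simp: loc_rel_def)
  show "refl_on {(n, s). s \<notin> p} (loc_rel scale p)"
    using prime_ideal_one[OF assms] by (auto simp: refl_on_def loc_rel_def)
  show "sym (loc_rel scale p)"
  proof (rule symI, clarsimp simp: loc_rel_def)
    fix n s n' s' u assume "u \<notin> p" "u *s (s' *s n - s *s n') = 0"
    then show "\<exists>u. u \<notin> p \<and> u *s (s *s n' - s' *s n) = 0"
      by (metis minus_diff_eq neg_equal_0_iff_equal scale_minus_right)
  qed
  show "trans (loc_rel scale p)"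
  proof (rule transI, clarsimp simp: loc_rel_def)
    fix n s n' s' n'' s'' u v
    assume notin: "s \<notin> p" "s' \<notin> p" "s'' \<notin> p" "u \<notin> p" "v \<notin> p"
      and u: "u *s (s' *s n - s *s n') = 0" and v: "v *s (s'' *s n' - s' *s n'') = 0"
    \<comment> \<open>The extra factor \<open>s'\<close> beside \<open>u\<close> and
      \<open>v\<close> allows \<open>n'\<close> to be eliminated from the two relations.\<close>
    have "(u * v * s') *s (s'' *s n - s *s n'')
        = (v * s'') *s (u *s (s' *s n - s *s n')) + (u * s) *s (v *s (s'' *s n' - s' *s n''))"
      by (simp add: scale_right_diff_distrib mult_ac)
    then have "(u * v * s') *s (s'' *s n - s *s n'') = 0" by (simp only: u v scale_zero_right add_0)
    moreover have "u * v * s' \<notin> p" using notin by (simp add: prime_ideal_mult[OF assms])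
    ultimately show "\<exists>u. u \<notin> p \<and> u *s (s'' *s n - s *s n'') = 0" by blast
  qed
qed

lemma frac_eq_iff:
  assumes "prime_ideal_r p" "s \<notin> p" "s' \<notin> p"
  shows "frac scale p n s = frac scale p n' s' \<longleftrightarrow> (\<exists>u. u \<notin> p \<and> u *s (s' *s n - s *s n') = 0)"
  unfolding frac_def using eq_equiv_class_iff[OF loc_rel_equiv[OF assms(1)], of "(n, s)" "(n', s')"]
    assms by (auto simp: loc_rel_def)

lemma frac_eqI:
  assumes "prime_ideal_r p" "s \<notin> p" "s' \<notin> p" "s' *s n = s *s n'"
  shows "frac scale p n s = frac scale p n' s'"
  using assms prime_ideal_one by (auto simp: frac_eq_iff)

text \<open>The operations on fractions apply \<open>SOME\<close> to a class. Here the chosen pair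
  is exposed as an equal fraction, so that independence of the choice reduces to
  \<open>frac_eq_iff\<close>.\<close>

lemma frac_representative:
  assumes "prime_ideal_r p" "s \<notin> p"
  obtains n' s' where "(SOME q. q \<in> frac scale p n s) = (n', s')" "s' \<notin> p"
    "frac scale p n s = frac scale p n' s'"
proof -
  obtain n' s' where q: "(SOME q. q \<in> frac scale p n s) = (n', s')" by fastforce
  have "(n, s) \<in> frac scale p n s"
    unfolding frac_def using equiv_class_self[OF loc_rel_equiv[OF assms(1)]] assms by simp
  then have "(n', s') \<in> frac scale p n s" unfolding q[symmetric] by (rule someI)
  moreover from this have rel: "((n, s), (n', s')) \<in> loc_rel scale p" by (simp add: frac_def)
  moreover from this have "s' \<notin> p" by (simp add: loc_rel_def)
  moreover have "frac scale p n s = frac scale p n' s'"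
    unfolding frac_def by (rule equiv_class_eq[OF loc_rel_equiv[OF assms(1)] rel])
  ultimately show thesis using that[OF q] by blast
qed

lemma loc_scale_frac:
  assumes "prime_ideal_r p" "s \<notin> p"
  shows "loc_scale scale p r (frac scale p n s) = frac scale p (r *s n) s"
proof -
  obtain n' s' where q: "(SOME q. q \<in> frac scale p n s) = (n', s')" "s' \<notin> p"
    "frac scale p n s = frac scale p n' s'"
    using frac_representative[OF assms, of n] by metis
  from q(3) obtain u where u: "u \<notin> p" "u *s (s' *s n - s *s n') = 0"
    using frac_eq_iff[OF assms q(2)] by blast
  have "u *s (s' *s (r *s n) - s *s (r *s n')) = r *s (u *s (s' *s n - s *s n'))"
    by (simp add: scale_right_diff_distrib mult_ac)
  with u have "frac scale p (r *s n) s = frac scale p (r *s n') s'"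
    using frac_eq_iff[OF assms q(2), of "r *s n" "r *s n'"] by auto
  then show ?thesis by (simp add: loc_scale_def q(1))
qed

lemma loc_add_frac:
  assumes "prime_ideal_r p" "s \<notin> p" "t \<notin> p"
  shows "loc_add scale p (frac scale p n s) (frac scale p m t) = frac scale p (t *s n + s *s m) (s * t)"
proof -
  obtain n' s' where q: "(SOME q. q \<in> frac scale p n s) = (n', s')" "s' \<notin> p"
    "frac scale p n s = frac scale p n' s'"
    using frac_representative[OF assms(1,2), of n] by metis
  obtain m' t' where r: "(SOME q. q \<in> frac scale p m t) = (m', t')" "t' \<notin> p"
    "frac scale p m t = frac scale p m' t'"
    using frac_representative[OF assms(1,3), of m] by metis
  from q(3) obtain u where u: "u \<notin> p" "u *s (s' *s n - s *s n') = 0"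
    using frac_eq_iff[OF assms(1,2) q(2)] by blast
  from r(3) obtain v where v: "v \<notin> p" "v *s (t' *s m - t *s m') = 0"
    using frac_eq_iff[OF assms(1,3) r(2)] by blast
  have "(u * v) *s ((s' * t') *s (t *s n + s *s m) - (s * t) *s (t' *s n' + s' *s m'))
      = (v * t * t') *s (u *s (s' *s n - s *s n')) + (u * s * s') *s (v *s (t' *s m - t *s m'))"
    by (simp add: scale_right_diff_distrib scale_right_distrib mult_ac)
  then have "(u * v) *s ((s' * t') *s (t *s n + s *s m) - (s * t) *s (t' *s n' + s' *s m')) = 0"
    by (simp only: u v scale_zero_right add_0)
  moreover have "u * v \<notin> p" "s * t \<notin> p" "s' * t' \<notin> p"
    using u v assms q r by (auto simp: prime_ideal_mult)
  ultimately have "frac scale p (t *s n + s *s m) (s * t) = frac scale p (t' *s n' + s' *s m') (s' * t')"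
    using frac_eq_iff[OF assms(1)] by blast
  then show ?thesis by (simp add: loc_add_def q(1) r(1))
qed

lemma loc_add_frac_same:
  assumes "prime_ideal_r p" "s \<notin> p"
  shows "loc_add scale p (frac scale p n s) (frac scale p m s) = frac scale p (n + m) s"
proof -
  have "s * s \<notin> p" using assms by (simp add: prime_ideal_mult)
  then show ?thesis
    unfolding loc_add_frac[OF assms assms(2)]
    by (rule frac_eqI[OF assms(1) _ assms(2)]) (simp add: scale_right_distrib)
qed

end

lemma loc_map_frac:
  assumes h: "module_hom scL scN h" and p: "prime_ideal_r p" "s \<notin> p"
  shows "loc_map scN p h (frac scL p n s) = frac scN p (h n) s"
proof -
  interpret h: module_hom scL scN h by fact
  obtain n' s' where q: "(SOME q. q \<in> frac scL p n s) = (n', s')" "s' \<notin> p"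
    "frac scL p n s = frac scL p n' s'"
    using h.m1.frac_representative[OF p, of n] by metis
  from q(3) obtain u where u: "u \<notin> p" "scL u (scL s' n - scL s n') = 0"
    using h.m1.frac_eq_iff[OF p q(2)] by blast
  have "scN u (scN s' (h n) - scN s (h n')) = h (scL u (scL s' n - scL s n'))"
    by (simp add: h.scale h.diff)
  with u have "frac scN p (h n) s = frac scN p (h n') s'"
    using h.m2.frac_eq_iff[OF p q(2)] by auto
  then show ?thesis by (simp add: loc_map_def q(1))
qed

subsection \<open>The ideal transform\<close>

lemma HomI_add: "\<phi> \<in> HomI sc J \<Longrightarrow> x \<in> J \<Longrightarrow> y \<in> J \<Longrightarrow> \<phi> (x + y) = \<phi> x + \<phi> y"
  and HomI_scale: "\<phi> \<in> HomI sc J \<Longrightarrow> x \<in> J \<Longrightarrow> \<phi> (r * x) = sc r (\<phi> x)"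
  by (simp_all add: HomI_def)

lemma restrict_HomI:
  assumes "ideal_r J" and "\<And>x y. x \<in> J \<Longrightarrow> y \<in> J \<Longrightarrow> \<psi> (x + y) = \<psi> x + \<psi> y"
    and "\<And>r x. x \<in> J \<Longrightarrow> \<psi> (r * x) = sc r (\<psi> x)"
  shows "restrict \<psi> J \<in> HomI sc J"
  using assms by (auto simp: HomI_def ideal_r_add ideal_r_mult)

lemma dl_rel_equiv: "equiv {(n, \<phi>). \<phi> \<in> HomI sc (ideal_pow I n)} (dl_rel sc I)"
proof (rule equivI)
  show "dl_rel sc I \<subseteq> {(n, \<phi>). \<phi> \<in> HomI sc (ideal_pow I n)} \<times> {(n, \<phi>). \<phi> \<in> HomI sc (ideal_pow I n)}"
    by (auto simp: dl_rel_def)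
  show "refl_on {(n, \<phi>). \<phi> \<in> HomI sc (ideal_pow I n)} (dl_rel sc I)"
    by (auto simp: refl_on_def dl_rel_def)
  show "sym (dl_rel sc I)"
    by (rule symI) (fastforce simp: dl_rel_def)
  show "trans (dl_rel sc I)"
  proof (rule transI, clarsimp simp: dl_rel_def)
    fix n :: nat and \<phi> :: "'a \<Rightarrow> 'b" and n' \<phi>' n'' \<phi>'' k k'
    assume k: "n \<le> k" "n' \<le> k" "\<forall>x\<in>ideal_pow I k. \<phi> x = \<phi>' x"
      and k': "n' \<le> k'" "n'' \<le> k'" "\<forall>x\<in>ideal_pow I k'. \<phi>' x = \<phi>'' x"
    have "ideal_pow I (max k k') \<subseteq> ideal_pow I k" "ideal_pow I (max k k') \<subseteq> ideal_pow I k'"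
      by (auto intro!: ideal_pow_antimono del: subsetI)
    with k k' have "n \<le> max k k' \<and> n'' \<le> max k k' \<and> (\<forall>x\<in>ideal_pow I (max k k'). \<phi> x = \<phi>'' x)"
      by (metis max.coboundedI1 max.coboundedI2 subsetD)
    then show "\<exists>k\<ge>n. n'' \<le> k \<and> (\<forall>x\<in>ideal_pow I k. \<phi> x = \<phi>'' x)" by blast
  qed
qed

lemma dl_class_eq_iff:
  assumes "\<phi> \<in> HomI sc (ideal_pow I n)" "\<phi>' \<in> HomI sc (ideal_pow I n')"
  shows "dl_class sc I n \<phi> = dl_class sc I n' \<phi>' \<longleftrightarrow>
    (\<exists>k. n \<le> k \<and> n' \<le> k \<and> (\<forall>x\<in>ideal_pow I k. \<phi> x = \<phi>' x))"
  unfolding dl_class_def using eq_equiv_class_iff[OF dl_rel_equiv, of "(n, \<phi>)" sc I "(n', \<phi>')"] assms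
  by (auto simp: dl_rel_def)

lemma mem_dl_class: "(n', \<phi>') \<in> dl_class sc I n \<phi> \<longleftrightarrow> ((n, \<phi>), (n', \<phi>')) \<in> dl_rel sc I"
  by (simp add: dl_class_def)

text \<open>The analogue of \<open>frac_representative\<close> for the direct limit, whose
  operations also choose representatives.\<close>

lemma transformD_representative:
  assumes "x \<in> transformD sc I"
  obtains n \<phi> where "(SOME q. q \<in> x) = (n, \<phi>)" "\<phi> \<in> HomI sc (ideal_pow I n)" "x = dl_class sc I n \<phi>"
proof -
  obtain n \<phi> where x: "x = dl_class sc I n \<phi>" "\<phi> \<in> HomI sc (ideal_pow I n)"
    using assms unfolding transformD_def by blast
  then have "(n, \<phi>) \<in> x" by (auto simp: mem_dl_class dl_rel_def)
  moreover obtain n' \<phi>' where q: "(SOME q. q \<in> x) = (n', \<phi>')" by fastforce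
  ultimately have "(n', \<phi>') \<in> x" by (metis someI)
  then have rel: "((n, \<phi>), (n', \<phi>')) \<in> dl_rel sc I" by (simp add: x(1) mem_dl_class)
  then have "\<phi>' \<in> HomI sc (ideal_pow I n')" by (simp add: dl_rel_def)
  moreover have "x = dl_class sc I n' \<phi>'"
    using equiv_class_eq[OF dl_rel_equiv rel] by (simp add: x(1) dl_class_def)
  ultimately show thesis using that[OF q] by blast
qed

subsection \<open>Sections off a closed set\<close>

text \<open>The open set D(I) of Spec(R). For I = (K:M) with \<open>M\<close> faithful and primeful
  it is Supp(U), by \<open>Supp_complement\<close>.\<close>

definition off_primes :: "'r::comm_ring_1 set \<Rightarrow> 'r set set" where
  "off_primes I = {p. prime_ideal_r p \<and> \<not> I \<subseteq> p}"

text \<open>The module A(N,M)(U) described over Spec(R) alone, with basic open sets D(c) as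
  neighbourhoods; \<open>sheafA_eq_sections\<close> identifies the two descriptions. Requiring
  \<open>q \<in> off_primes I\<close> says that D(c) lies in D(I).\<close>

definition sections :: "('r::comm_ring_1 \<Rightarrow> 'n::ab_group_add \<Rightarrow> 'n) \<Rightarrow> 'r set \<Rightarrow> ('r, 'n) sect set" where
  "sections sc I = {\<gamma> \<in> extensional (off_primes I). \<forall>p\<in>off_primes I. \<exists>c s m. c \<notin> p \<and>
     (\<forall>q. prime_ideal_r q \<and> c \<notin> q \<longrightarrow> q \<in> off_primes I \<and> s \<notin> q \<and> \<gamma> q = frac sc q m s)}"

text \<open>The value does not depend on the choice of \<open>a\<close>, since \<open>b \<phi>(a) = \<phi>(a b) = a \<phi>(b)\<close>.\<close>
definition sect_of :: "('r::comm_ring_1 \<Rightarrow> 'n::ab_group_add \<Rightarrow> 'n) \<Rightarrow> 'r set \<Rightarrow>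
    (nat \<times> ('r \<Rightarrow> 'n)) set \<Rightarrow> ('r, 'n) sect" where
  "sect_of sc I x = (\<lambda>p\<in>off_primes I.
     SOME z. \<exists>n \<phi> a. (n, \<phi>) \<in> x \<and> a \<in> ideal_pow I n \<and> a \<notin> p \<and> z = frac sc p (\<phi> a) a)"

text \<open>The multiple \<open>x \<gamma>\<close> is the image of \<open>m\<close> under the
  canonical map \<epsilon>. For a section \<open>\<gamma>\<close> such pairs (x, m) form a submodule
  of R x N, and a preimage in the ideal transform is built by picking \<open>m\<close> linearly in
  \<open>x\<close>.\<close>

definition represents :: "('r::comm_ring_1 \<Rightarrow> 'n::ab_group_add \<Rightarrow> 'n) \<Rightarrow> 'r set \<Rightarrow>
    ('r, 'n) sect \<Rightarrow> 'r \<Rightarrow> 'n \<Rightarrow> bool" where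
  "represents sc I \<gamma> x m \<longleftrightarrow> (\<forall>p\<in>off_primes I. loc_scale sc p x (\<gamma> p) = frac sc p m 1)"

lemma off_primes_prime: "p \<in> off_primes I \<Longrightarrow> prime_ideal_r p"
  by (simp add: off_primes_def)

lemma off_primes_obtain:
  assumes "p \<in> off_primes I"
  obtains a where "a \<in> ideal_pow I n" "a \<notin> p"
  using assms ideal_pow_not_subset_prime[of p I n] by (auto simp: off_primes_def)

lemma off_primesI: "prime_ideal_r q \<Longrightarrow> c \<in> I \<Longrightarrow> c \<notin> q \<Longrightarrow> q \<in> off_primes I"
  by (auto simp: off_primes_def)

lemma dl_class_in_transformD: "\<phi> \<in> HomI sc (ideal_pow I n) \<Longrightarrow> dl_class sc I n \<phi> \<in> transformD sc I"
  unfolding transformD_def by blast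

lemma sections_local:
  assumes "\<gamma> \<in> sections sc I" "p \<in> off_primes I"
  obtains c s m where "c \<notin> p" and "\<forall>q. prime_ideal_r q \<and> c \<notin> q \<longrightarrow>
      q \<in> off_primes I \<and> s \<notin> q \<and> \<gamma> q = frac sc q m s"
proof -
  from assms have "\<exists>c s m. c \<notin> p \<and> (\<forall>q. prime_ideal_r q \<and> c \<notin> q \<longrightarrow>
      q \<in> off_primes I \<and> s \<notin> q \<and> \<gamma> q = frac sc q m s)"
    by (simp add: sections_def)
  then show thesis using that by (elim exE conjE)
qed

lemma sections_obtain:
  assumes "\<gamma> \<in> sections sc I" "p \<in> off_primes I"
  obtains n s where "s \<notin> p" "\<gamma> p = frac sc p n s"
  using sections_local[OF assms] off_primes_prime[OF assms(2)] by metis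

section \<open>The map from the ideal transform to sections\<close>

context module
begin

lemma frac_hom_eq:
  assumes "prime_ideal_r p" "\<phi> \<in> HomI scale J" "a \<in> J" "a \<notin> p" "b \<in> J" "b \<notin> p"
  shows "frac scale p (\<phi> a) a = frac scale p (\<phi> b) b"
  using assms HomI_scale[OF assms(2,3), of b] HomI_scale[OF assms(2,5), of a]
  by (intro frac_eqI) (simp_all add: mult.commute)

text \<open>Any representative may be used for evaluation: two representatives agree on some I^k,
  and an element \<open>b\<close> of I^k outside \<open>p\<close> serves as denominator for
  both.\<close>

lemma sect_of_class:
  assumes p: "p \<in> off_primes I" and \<phi>: "\<phi> \<in> HomI scale (ideal_pow I n)"
    and a: "a \<in> ideal_pow I n" "a \<notin> p"
  shows "sect_of scale I (dl_class scale I n \<phi>) p = frac scale p (\<phi> a) a"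
proof -
  note pp = off_primes_prime[OF p]
  have "(SOME z. \<exists>n' \<phi>' a. (n', \<phi>') \<in> dl_class scale I n \<phi> \<and> a \<in> ideal_pow I n' \<and> a \<notin> p \<and>
      z = frac scale p (\<phi>' a) a) = frac scale p (\<phi> a) a"
  proof (rule some_equality)
    have "(n, \<phi>) \<in> dl_class scale I n \<phi>" using \<phi> by (auto simp: mem_dl_class dl_rel_def)
    with a show "\<exists>n' \<phi>' b. (n', \<phi>') \<in> dl_class scale I n \<phi> \<and> b \<in> ideal_pow I n' \<and> b \<notin> p \<and>
      frac scale p (\<phi> a) a = frac scale p (\<phi>' b) b" by blast
  next
    fix z assume "\<exists>n' \<phi>' a. (n', \<phi>') \<in> dl_class scale I n \<phi> \<and> a \<in> ideal_pow I n' \<and> a \<notin> p \<and>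
      z = frac scale p (\<phi>' a) a"
    then obtain n' \<phi>' a' where rel: "((n, \<phi>), (n', \<phi>')) \<in> dl_rel scale I"
      and a': "a' \<in> ideal_pow I n'" "a' \<notin> p" and z: "z = frac scale p (\<phi>' a') a'"
      by (auto simp: mem_dl_class)
    from rel obtain k where \<phi>': "\<phi>' \<in> HomI scale (ideal_pow I n')"
      and k: "n \<le> k" "n' \<le> k" "\<forall>x\<in>ideal_pow I k. \<phi> x = \<phi>' x"
      by (auto simp: dl_rel_def)
    obtain b where b: "b \<in> ideal_pow I k" "b \<notin> p" using off_primes_obtain[OF p] .
    have b': "b \<in> ideal_pow I n" "b \<in> ideal_pow I n'"
      using b(1) ideal_pow_antimono[OF k(1), of I] ideal_pow_antimono[OF k(2), of I] by blast+
    show "z = frac scale p (\<phi> a) a"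
      unfolding z frac_hom_eq[OF pp \<phi> a b'(1) b(2)] frac_hom_eq[OF pp \<phi>' a' b'(2) b(2)]
      using k(3) b(1) by simp
  qed
  with p show ?thesis by (simp add: sect_of_def)
qed

lemma sect_of_extensional: "sect_of scale I x \<in> extensional (off_primes I)"
  by (simp add: sect_of_def)

text \<open>For \<open>c\<close> in \<open>I\<close>, the power \<open>c ^ n\<close> is a
  denominator valid on all of D(c), with the single numerator \<open>\<phi> (c ^ n)\<close>.\<close>

lemma sect_of_in_sections:
  assumes "x \<in> transformD scale I"
  shows "sect_of scale I x \<in> sections scale I"
proof -
  obtain n \<phi> where x: "\<phi> \<in> HomI scale (ideal_pow I n)" "x = dl_class scale I n \<phi>"
    using transformD_representative[OF assms] by metis
  have "\<exists>c s m. c \<notin> p \<and> (\<forall>q. prime_ideal_r q \<and> c \<notin> q \<longrightarrow>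
      q \<in> off_primes I \<and> s \<notin> q \<and> sect_of scale I x q = frac scale q m s)"
    if p: "p \<in> off_primes I" for p
  proof -
    obtain c where c: "c \<in> I" "c \<notin> p" using p by (auto simp: off_primes_def)
    have "q \<in> off_primes I \<and> c ^ n \<notin> q \<and> sect_of scale I x q = frac scale q (\<phi> (c ^ n)) (c ^ n)"
      if q: "prime_ideal_r q" "c \<notin> q" for q
    proof -
      have "q \<in> off_primes I" "c ^ n \<notin> q"
        using off_primesI[OF q(1) c(1) q(2)] prime_ideal_power[OF q(1)] q(2) by blast+
      with sect_of_class[OF _ x(1) ideal_pow_power[OF c(1)]] x(2) show ?thesis by simp
    qed
    with c(2) show ?thesis by blast
  qed
  then show ?thesis by (simp add: sections_def sect_of_extensional)
qed

lemma sect_of_etaD: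
  "sect_of scale I (etaD scale I n) = (\<lambda>p\<in>off_primes I. frac scale p n 1)"
  and etaD_in: "etaD scale I n \<in> transformD scale I"
proof -
  have H: "(\<lambda>r. r *s n) \<in> HomI scale (ideal_pow I 0)"
    by (simp add: HomI_def scale_left_distrib)
  then show "etaD scale I n \<in> transformD scale I"
    unfolding etaD_def by (rule dl_class_in_transformD)
  show "sect_of scale I (etaD scale I n) = (\<lambda>p\<in>off_primes I. frac scale p n 1)"
  proof (rule extensionalityI[OF sect_of_extensional restrict_extensional])
    fix p assume p: "p \<in> off_primes I"
    show "sect_of scale I (etaD scale I n) p = (\<lambda>p\<in>off_primes I. frac scale p n 1) p"
      using sect_of_class[OF p H, of 1] prime_ideal_one[OF off_primes_prime[OF p]] p
      by (simp add: etaD_def)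
  qed
qed

lemma sect_of_add:
  assumes "x \<in> transformD scale I" "y \<in> transformD scale I"
  shows "sect_of scale I (transformD_add scale I x y)
      = (\<lambda>p\<in>off_primes I. loc_add scale p (sect_of scale I x p) (sect_of scale I y p))"
    and "transformD_add scale I x y \<in> transformD scale I"
proof -
  obtain n \<phi> where x: "(SOME q. q \<in> x) = (n, \<phi>)" "\<phi> \<in> HomI scale (ideal_pow I n)" "x = dl_class scale I n \<phi>"
    using transformD_representative[OF assms(1)] .
  obtain n' \<phi>' where y: "(SOME q. q \<in> y) = (n', \<phi>')" "\<phi>' \<in> HomI scale (ideal_pow I n')" "y = dl_class scale I n' \<phi>'"
    using transformD_representative[OF assms(2)] .
  define k where "k = max n n'"
  have sub: "ideal_pow I k \<subseteq> ideal_pow I n" "ideal_pow I k \<subseteq> ideal_pow I n'"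
    unfolding k_def by (simp_all add: ideal_pow_antimono)
  let ?s = "\<lambda>a\<in>ideal_pow I k. \<phi> a + \<phi>' a"
  have H: "?s \<in> HomI scale (ideal_pow I k)"
    using sub HomI_add[OF x(2)] HomI_add[OF y(2)] HomI_scale[OF x(2)] HomI_scale[OF y(2)]
    by (intro restrict_HomI ideal_pow_ideal) (auto simp: subset_iff scale_right_distrib)
  have eq: "transformD_add scale I x y = dl_class scale I k ?s"
    by (simp add: transformD_add_def x(1) y(1) k_def Let_def)
  show "transformD_add scale I x y \<in> transformD scale I"
    unfolding eq by (rule dl_class_in_transformD[OF H])
  show "sect_of scale I (transformD_add scale I x y)
      = (\<lambda>p\<in>off_primes I. loc_add scale p (sect_of scale I x p) (sect_of scale I y p))"
  proof (rule extensionalityI[OF sect_of_extensional restrict_extensional])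
    fix p assume p: "p \<in> off_primes I"
    \<comment> \<open>An element of I^k outside \<open>p\<close> is a denominator for both summands
      and for the sum, so only numerators are added.\<close>
    obtain a where a: "a \<in> ideal_pow I k" "a \<notin> p" using off_primes_obtain[OF p] .
    show "sect_of scale I (transformD_add scale I x y) p
        = (\<lambda>p\<in>off_primes I. loc_add scale p (sect_of scale I x p) (sect_of scale I y p)) p"
      unfolding eq
      using sect_of_class[OF p H a] sect_of_class[OF p x(2) _ a(2)] sect_of_class[OF p y(2) _ a(2)]
        sub a p loc_add_frac_same[OF off_primes_prime[OF p] a(2)]
      by (simp add: x(3) y(3) subset_iff)
  qed
qed

lemma sect_of_scale:
  assumes "x \<in> transformD scale I"
  shows "sect_of scale I (transformD_scale scale I r x)
      = (\<lambda>p\<in>off_primes I. loc_scale scale p r (sect_of scale I x p))"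
    and "transformD_scale scale I r x \<in> transformD scale I"
proof -
  obtain n \<phi> where x: "(SOME q. q \<in> x) = (n, \<phi>)" "\<phi> \<in> HomI scale (ideal_pow I n)" "x = dl_class scale I n \<phi>"
    using transformD_representative[OF assms(1)] .
  let ?s = "\<lambda>a\<in>ideal_pow I n. r *s \<phi> a"
  have H: "?s \<in> HomI scale (ideal_pow I n)"
    using HomI_add[OF x(2)] HomI_scale[OF x(2)]
    by (intro restrict_HomI ideal_pow_ideal) (simp_all add: scale_right_distrib mult.commute[of _ r])
  have eq: "transformD_scale scale I r x = dl_class scale I n ?s"
    by (simp add: transformD_scale_def x(1))
  show "transformD_scale scale I r x \<in> transformD scale I"
    unfolding eq by (rule dl_class_in_transformD[OF H])
  show "sect_of scale I (transformD_scale scale I r x)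
      = (\<lambda>p\<in>off_primes I. loc_scale scale p r (sect_of scale I x p))"
  proof (rule extensionalityI[OF sect_of_extensional restrict_extensional])
    fix p assume p: "p \<in> off_primes I"
    obtain a where a: "a \<in> ideal_pow I n" "a \<notin> p" using off_primes_obtain[OF p] .
    show "sect_of scale I (transformD_scale scale I r x) p
        = (\<lambda>p\<in>off_primes I. loc_scale scale p r (sect_of scale I x p)) p"
      unfolding eq
      using sect_of_class[OF p H a] sect_of_class[OF p x(2) a] a p
        loc_scale_frac[OF off_primes_prime[OF p] a(2)]
      by (simp add: x(3))
  qed
qed

end

lemma sect_of_map:
  assumes h: "module_hom scL scN h" and x: "x \<in> transformD scL I"
  shows "sect_of scN I (transformD_map scN I h x)
      = (\<lambda>p\<in>off_primes I. loc_map scN p h (sect_of scL I x p))"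
    and "transformD_map scN I h x \<in> transformD scN I"
proof -
  interpret h: module_hom scL scN h by fact
  obtain n \<phi> where x: "(SOME q. q \<in> x) = (n, \<phi>)" "\<phi> \<in> HomI scL (ideal_pow I n)" "x = dl_class scL I n \<phi>"
    using transformD_representative[OF x] .
  let ?s = "\<lambda>a\<in>ideal_pow I n. h (\<phi> a)"
  have H: "?s \<in> HomI scN (ideal_pow I n)"
    by (intro restrict_HomI ideal_pow_ideal)
      (simp_all only: HomI_add[OF x(2)] HomI_scale[OF x(2)] h.add h.scale)
  have eq: "transformD_map scN I h x = dl_class scN I n ?s"
    by (simp add: transformD_map_def x(1))
  show "transformD_map scN I h x \<in> transformD scN I"
    unfolding eq by (rule dl_class_in_transformD[OF H])
  show "sect_of scN I (transformD_map scN I h x)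
      = (\<lambda>p\<in>off_primes I. loc_map scN p h (sect_of scL I x p))"
  proof (rule extensionalityI[OF h.m2.sect_of_extensional restrict_extensional])
    fix p assume p: "p \<in> off_primes I"
    obtain a where a: "a \<in> ideal_pow I n" "a \<notin> p" using off_primes_obtain[OF p] .
    show "sect_of scN I (transformD_map scN I h x) p
        = (\<lambda>p\<in>off_primes I. loc_map scN p h (sect_of scL I x p)) p"
      unfolding eq
      using h.m2.sect_of_class[OF p H a] h.m1.sect_of_class[OF p x(2) a] a p
        loc_map_frac[OF h off_primes_prime[OF p] a(2)]
      by (simp add: x(3))
  qed
qed

subsection \<open>Sections come from the ideal transform\<close>

lemma noetherian_chain:
  fixes E :: "nat \<Rightarrow> 'r::comm_ring_1 set"
  assumes "noetherian_ring TYPE('r)" and "\<And>k. ideal_r (E k)" and "mono E"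
  shows "\<exists>k. \<forall>i. E i \<subseteq> E k"
proof -
  define P where "P b \<longleftrightarrow> (\<exists>k. b = E k)" for b
  have P: "P (E k)" for k by (auto simp: P_def)
  obtain b where "P b" and max: "\<And>b'. ideal_r b' \<Longrightarrow> P b' \<Longrightarrow> b \<subseteq> b' \<Longrightarrow> b' = b"
    using noetherian_maximal_ideal[of "E 0" P, OF assms(1,2) P] by blast
  then obtain k where b: "b = E k" unfolding P_def by blast
  have "E i \<subseteq> E k" for i
  proof -
    have "E k \<subseteq> E (max i k)" "E i \<subseteq> E (max i k)" using assms(3) by (auto simp: mono_def)
    moreover from this have "E (max i k) = E k" using max[OF assms(2) P, of "max i k"] b by simp
    ultimately show ?thesis by simp
  qed
  then show ?thesis by blast
qed

text \<open>Unlike in \<open>HomI\<close>, nothing is required outside \<open>b\<close>, so a map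
  can be extended repeatedly and restricted once at the end.\<close>

definition partial_hom :: "('r::comm_ring_1 \<Rightarrow> 'n::ab_group_add \<Rightarrow> 'n) \<Rightarrow> 'r set \<Rightarrow> ('r \<Rightarrow> 'n) \<Rightarrow> bool" where
  "partial_hom sc b \<psi> \<longleftrightarrow>
     (\<forall>x\<in>b. \<forall>y\<in>b. \<psi> (x + y) = \<psi> x + \<psi> y) \<and> (\<forall>r. \<forall>x\<in>b. \<psi> (r * x) = sc r (\<psi> x))"

lemma partial_hom_add: "partial_hom sc b \<psi> \<Longrightarrow> x \<in> b \<Longrightarrow> y \<in> b \<Longrightarrow> \<psi> (x + y) = \<psi> x + \<psi> y"
  and partial_hom_scale: "partial_hom sc b \<psi> \<Longrightarrow> x \<in> b \<Longrightarrow> \<psi> (r * x) = sc r (\<psi> x)"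
  by (simp_all add: partial_hom_def)

context module
begin

text \<open>The map \<open>\<psi>\<close> on \<open>b\<close> and the assignment of
  \<open>r *s m\<close> to \<open>r * y\<close> glue to \<open>b + (y)\<close> as soon as they agree
  on the intersection of \<open>b\<close> and (y), which is what \<open>compat\<close> says.\<close>

lemma partial_hom_extend:
  assumes b: "ideal_r b" and \<psi>: "partial_hom scale b \<psi>"
    and compat: "\<And>r. r * y \<in> b \<Longrightarrow> \<psi> (r * y) = r *s m"
  obtains \<psi>' where "partial_hom scale (add_principal b y) \<psi>'"
    "\<forall>a\<in>b. \<forall>r. \<psi>' (a + r * y) = \<psi> a + r *s m"
proof -
  define \<psi>' where "\<psi>' z = (SOME w. \<exists>a r. a \<in> b \<and> z = a + r * y \<and> w = \<psi> a + r *s m)" for z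
  have val: "\<psi>' (a + r * y) = \<psi> a + r *s m" if a: "a \<in> b" for a r
    unfolding \<psi>'_def
  proof (rule some_equality)
    show "\<exists>a' r'. a' \<in> b \<and> a + r * y = a' + r' * y \<and> \<psi> a + r *s m = \<psi> a' + r' *s m"
      using a by blast
  next
    fix w assume "\<exists>a' r'. a' \<in> b \<and> a + r * y = a' + r' * y \<and> w = \<psi> a' + r' *s m"
    then obtain a' r' where a': "a' \<in> b" "a + r * y = a' + r' * y" "w = \<psi> a' + r' *s m" by blast
    \<comment> \<open>The two expressions of the same element differ by a multiple of
      \<open>y\<close> lying in \<open>b\<close>, where \<open>compat\<close> applies.\<close>
    have d: "(r - r') * y = a' + (- 1) * a" using a'(2) by (simp add: algebra_simps)
    then have mem: "(r - r') * y \<in> b"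
      using ideal_r_add[OF b a'(1) ideal_r_mult[OF b a, of "- 1"]] by simp
    have "a' = a + (r - r') * y" using d by simp
    then have "\<psi> a' = \<psi> a + (r - r') *s m"
      using partial_hom_add[OF \<psi> a mem] compat[OF mem] by simp
    then show "w = \<psi> a + r *s m" by (simp add: a'(3) scale_left_diff_distrib)
  qed
  have "partial_hom scale (add_principal b y) \<psi>'"
    unfolding partial_hom_def
  proof (intro conjI ballI allI)
    fix u v assume "u \<in> add_principal b y" "v \<in> add_principal b y"
    then obtain a r a' r' where u: "u = a + r * y" "a \<in> b" and v: "v = a' + r' * y" "a' \<in> b"
      by (metis add_principalE)
    have uv: "u + v = (a + a') + (r + r') * y" by (simp add: u v algebra_simps)
    have "\<psi>' (u + v) = (\<psi> a + r *s m) + (\<psi> a' + r' *s m)"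
      unfolding uv val[OF ideal_r_add[OF b u(2) v(2)]]
      by (simp add: partial_hom_add[OF \<psi> u(2) v(2)] scale_left_distrib)
    then show "\<psi>' (u + v) = \<psi>' u + \<psi>' v"
      unfolding u(1) v(1) val[OF u(2)] val[OF v(2)] .
  next
    fix c u assume "u \<in> add_principal b y"
    then obtain a r where u: "u = a + r * y" "a \<in> b" by (rule add_principalE)
    have cu: "c * u = c * a + (c * r) * y" by (simp add: u algebra_simps)
    have "\<psi>' (c * u) = c *s (\<psi> a + r *s m)"
      unfolding cu val[OF ideal_r_mult[OF b u(2)]]
      by (simp add: partial_hom_scale[OF \<psi> u(2)] scale_right_distrib)
    then show "\<psi>' (c * u) = c *s \<psi>' u" unfolding u(1) val[OF u(2)] .
  qed
  moreover have "\<forall>a\<in>b. \<forall>r. \<psi>' (a + r * y) = \<psi> a + r *s m" using val by simp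
  ultimately show thesis by (rule that)
qed

lemma annihilator_ideal: "ideal_r {r. r *s m = 0}"
  by (rule ideal_rI) (simp_all add: scale_left_distrib flip: scale_scale)

lemma loc_scale_eq_iff:
  assumes "prime_ideal_r p" "s \<notin> p"
  shows "loc_scale scale p x (frac scale p n s) = frac scale p m 1 \<longleftrightarrow>
    (\<exists>u. u \<notin> p \<and> u *s (x *s n - s *s m) = 0)"
  using frac_eq_iff[OF assms prime_ideal_one[OF assms(1)]] by (simp add: loc_scale_frac[OF assms])

lemma loc_scale_mult:
  assumes "prime_ideal_r p" "s \<notin> p" "loc_scale scale p x (frac scale p n s) = frac scale p m 1"
  shows "loc_scale scale p (r * x) (frac scale p n s) = frac scale p (r *s m) 1"
proof -
  obtain u where u: "u \<notin> p" "u *s (x *s n - s *s m) = 0"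
    using assms(3) unfolding loc_scale_eq_iff[OF assms(1,2)] by blast
  have "u *s ((r * x) *s n - s *s (r *s m)) = r *s (u *s (x *s n - s *s m))"
    by (simp add: scale_right_diff_distrib mult_ac)
  with u show ?thesis unfolding loc_scale_eq_iff[OF assms(1,2)] by auto
qed

lemma represents_scale:
  assumes "\<gamma> \<in> sections scale I" "represents scale I \<gamma> x m"
  shows "represents scale I \<gamma> (r * x) (r *s m)"
  unfolding represents_def
proof
  fix p assume p: "p \<in> off_primes I"
  obtain n s where s: "s \<notin> p" "\<gamma> p = frac scale p n s" using sections_obtain[OF assms(1) p] .
  have "loc_scale scale p x (frac scale p n s) = frac scale p m 1"
    using assms(2) p by (simp add: represents_def flip: s(2))
  then show "loc_scale scale p (r * x) (\<gamma> p) = frac scale p (r *s m) 1"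
    unfolding s(2) by (rule loc_scale_mult[OF off_primes_prime[OF p] s(1)])
qed

lemma represents_add:
  assumes "\<gamma> \<in> sections scale I" "represents scale I \<gamma> x m" "represents scale I \<gamma> y l"
  shows "represents scale I \<gamma> (x + y) (m + l)"
  unfolding represents_def
proof
  fix p assume p: "p \<in> off_primes I"
  note pp = off_primes_prime[OF p]
  obtain n s where s: "s \<notin> p" "\<gamma> p = frac scale p n s" using sections_obtain[OF assms(1) p] .
  obtain u where u: "u \<notin> p" "u *s (x *s n - s *s m) = 0"
    using assms(2) p s(2) loc_scale_eq_iff[OF pp s(1)] unfolding represents_def by metis
  obtain v where v: "v \<notin> p" "v *s (y *s n - s *s l) = 0"
    using assms(3) p s(2) loc_scale_eq_iff[OF pp s(1)] unfolding represents_def by metis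
  have "(u * v) *s ((x + y) *s n - s *s (m + l))
      = v *s (u *s (x *s n - s *s m)) + u *s (v *s (y *s n - s *s l))"
    by (simp add: scale_right_diff_distrib scale_right_distrib scale_left_distrib mult_ac)
  also have "\<dots> = 0" by (simp only: u v scale_zero_right add_0)
  finally have "(u * v) *s ((x + y) *s n - s *s (m + l)) = 0" .
  moreover have "u * v \<notin> p" using u v by (simp add: prime_ideal_mult[OF pp])
  ultimately show "loc_scale scale p (x + y) (\<gamma> p) = frac scale p (m + l) 1"
    unfolding s(2) loc_scale_eq_iff[OF pp s(1)] by blast
qed

text \<open>With \<gamma> = n/s at \<open>p\<close>, the condition for \<open>x \<gamma>\<close> =
  m/1 is literally the one for \<gamma> = m/x. Both surjectivity and uniqueness recover a section
  from its represented multiples in this way.\<close>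

lemma represents_frac:
  assumes "\<gamma> \<in> sections scale I" "represents scale I \<gamma> x m" "p \<in> off_primes I" "x \<notin> p"
  shows "\<gamma> p = frac scale p m x"
proof -
  note pp = off_primes_prime[OF assms(3)]
  obtain n s where s: "s \<notin> p" "\<gamma> p = frac scale p n s" using sections_obtain[OF assms(1,3)] .
  have "loc_scale scale p x (frac scale p n s) = frac scale p m 1"
    using assms(2,3) by (simp add: represents_def flip: s(2))
  then show ?thesis
    unfolding s(2) loc_scale_eq_iff[OF pp s(1)] frac_eq_iff[OF pp s(1) assms(4)] .
qed

end

section \<open>Bijectivity over a Noetherian ring\<close>

locale noetherian_module = module scale
  for scale :: "'r::comm_ring_1 \<Rightarrow> 'n::ab_group_add \<Rightarrow> 'n" (infixr \<open>*s\<close> 75) +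
  fixes I :: "'r set"
  assumes noeth: "noetherian_ring TYPE('r)" and I: "ideal_r I"
begin

text \<open>At every prime of D(I) the fraction m/1 is zero, so every prime containing the
  annihilator of \<open>m\<close> contains \<open>x\<close>. Hence the annihilator contains a power
  of \<open>x\<close>.\<close>

lemma represents_zero_torsion:
  assumes \<gamma>: "\<gamma> \<in> sections scale I" and "represents scale I \<gamma> 0 m" and x: "x \<in> I"
  shows "\<exists>j. x ^ j *s m = 0"
proof -
  have "\<exists>j. x ^ j \<in> {r. r *s m = 0}"
  proof (rule power_mem_if_primes[OF noeth annihilator_ideal])
    fix p assume pp: "prime_ideal_r p" and sub: "{r. r *s m = 0} \<subseteq> p"
    show "x \<in> p"
    proof (rule ccontr)
      assume "x \<notin> p"
      then have p: "p \<in> off_primes I" by (rule off_primesI[OF pp x])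
      obtain n s where s: "s \<notin> p" "\<gamma> p = frac scale p n s" using sections_obtain[OF \<gamma> p] .
      obtain u where u: "u \<notin> p" "u *s (0 *s n - s *s m) = 0"
        using assms(2) p s(2) loc_scale_eq_iff[OF pp s(1)] unfolding represents_def by metis
      then have "(u * s) *s m = 0" by simp
      with sub have "u * s \<in> p" by blast
      with u s show False by (simp add: prime_ideal_mult[OF pp])
    qed
  qed
  then show ?thesis by simp
qed

text \<open>A local denominator \<open>s\<close> on \<open>D(c)\<close> becomes a global one after multiplication by a power
  of \<open>c\<close>.\<close>
lemma represents_off_prime:
  assumes \<gamma>: "\<gamma> \<in> sections scale I" and p: "p \<in> off_primes I"
  shows "\<exists>x m. x \<in> I \<and> x \<notin> p \<and> represents scale I \<gamma> x m"
proof -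
  note pp = off_primes_prime[OF p]
  obtain c s m where c: "c \<notin> p" and loc: "\<forall>q. prime_ideal_r q \<and> c \<notin> q \<longrightarrow>
      q \<in> off_primes I \<and> s \<notin> q \<and> \<gamma> q = frac scale q m s"
    by (rule sections_local[OF \<gamma> p])
  have csm: "s \<notin> q" "\<gamma> q = frac scale q m s" if "prime_ideal_r q" "c \<notin> q" for q
    using loc that by simp_all
  \<comment> \<open>One exponent \<open>k\<close> has to work at all primes of D(I) that do not
    contain \<open>b\<close>. The factor \<open>c ^ k\<close> is there to make the equation hold
    also at primes that contain \<open>c\<close>, where the local description by m/s says
    nothing.\<close>
  define P where "P b \<longleftrightarrow> (\<exists>k. \<forall>q\<in>off_primes I. \<not> b \<subseteq> q \<longrightarrow>
    loc_scale scale q (c ^ k * s) (\<gamma> q) = frac scale q (c ^ k *s m) 1)" for b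
  have "\<exists>b n. ideal_r b \<and> P b \<and> ideal_pow I n \<subseteq> b"
  proof (rule noetherian_cover_induct[OF noeth I])
    show "P {0}" by (auto simp: P_def off_primes_def prime_ideal_r_def ideal_r_zero)
  next
    fix b p' assume b: "ideal_r b" "P b" and p': "prime_ideal_r p'" "\<not> I \<subseteq> p'"
    then have p'off: "p' \<in> off_primes I" by (simp add: off_primes_def)
    obtain c' s' m' where c': "c' \<notin> p'" and loc': "\<forall>q. prime_ideal_r q \<and> c' \<notin> q \<longrightarrow>
        q \<in> off_primes I \<and> s' \<notin> q \<and> \<gamma> q = frac scale q m' s'"
      by (rule sections_local[OF \<gamma> p'off])
    have csm': "s' \<notin> q" "\<gamma> q = frac scale q m' s'" if "prime_ideal_r q" "c' \<notin> q" for q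
      using loc' that by simp_all
    from b(2) obtain k where k': "\<forall>q\<in>off_primes I. \<not> b \<subseteq> q \<longrightarrow>
        loc_scale scale q (c ^ k * s) (\<gamma> q) = frac scale q (c ^ k *s m) 1"
      unfolding P_def by (elim exE)
    note k = k'[rule_format]
    \<comment> \<open>On D(c c') both descriptions of \<open>\<gamma>\<close> are valid, so a power
      of \<open>c * c'\<close> kills the difference of the cross products.\<close>
    have "\<exists>j. (c * c') ^ j \<in> {r. r *s (s *s m' - s' *s m) = 0}"
    proof (rule power_mem_if_primes[OF noeth annihilator_ideal])
      fix q assume q: "prime_ideal_r q" and sub: "{r. r *s (s *s m' - s' *s m) = 0} \<subseteq> q"
      show "c * c' \<in> q"
      proof (rule ccontr)
        assume "c * c' \<notin> q"
        then have nq: "c \<notin> q" "c' \<notin> q" by (simp_all add: prime_ideal_mult[OF q])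
        then have "frac scale q m' s' = frac scale q m s" using csm(2) csm'(2) q by metis
        then obtain u where "u \<notin> q" "u *s (s *s m' - s' *s m) = 0"
          using frac_eq_iff[OF q csm'(1)[OF q nq(2)] csm(1)[OF q nq(1)]] by blast
        with sub show False by blast
      qed
    qed
    then obtain j where j: "(c * c') ^ j *s (s *s m' - s' *s m) = 0" by blast
    \<comment> \<open>At primes not containing \<open>b\<close>, the equation for \<open>k\<close>
      survives multiplication by \<open>c ^ j\<close>; the remaining primes must miss
      \<open>c'\<close>.\<close>
    have "loc_scale scale q (c ^ (j + k) * s) (\<gamma> q) = frac scale q (c ^ (j + k) *s m) 1"
      if q: "q \<in> off_primes I" and nsub: "\<not> add_principal b c' \<subseteq> q" for q
    proof (cases "b \<subseteq> q")
      case False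
      obtain n t where t: "t \<notin> q" "\<gamma> q = frac scale q n t" using sections_obtain[OF \<gamma> q] .
      show ?thesis
        using loc_scale_mult[OF off_primes_prime[OF q] t(1) k[OF q False, unfolded t(2)], of "c ^ j"]
        by (simp add: t(2) power_add mult.assoc)
    next
      case True
      note qq = off_primes_prime[OF q]
      have "ideal_r q" using qq by (simp add: prime_ideal_r_def)
      have "c' \<notin> q"
      proof
        assume "c' \<in> q"
        then have "add_principal b c' \<subseteq> q"
          using True ideal_r_add[OF \<open>ideal_r q\<close>] ideal_r_mult[OF \<open>ideal_r q\<close>]
          by (auto elim!: add_principalE)
        with nsub show False by blast
      qed
      \<comment> \<open>As \<open>c' ^ j\<close> lies outside \<open>q\<close>, it can witness the
        equality of fractions; the matching power of \<open>c\<close> is absorbed by the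
        multiplier.\<close>
      moreover have "c' ^ j *s ((c ^ (j + k) * s) *s m' - s' *s (c ^ (j + k) *s m))
          = c ^ k *s ((c * c') ^ j *s (s *s m' - s' *s m))"
        by (simp add: scale_right_diff_distrib power_add power_mult_distrib mult_ac)
      ultimately show ?thesis
        using loc_scale_eq_iff[OF qq csm'(1)[OF qq]] csm'(2)[OF qq] prime_ideal_power[OF qq, of c' j] j
        by (metis scale_zero_right)
    qed
    then have "P (add_principal b c')" unfolding P_def by (intro exI[of _ "j + k"]) simp
    with c' show "\<exists>x. x \<notin> p' \<and> P (add_principal b x)" by blast
  qed
  then obtain b n k where b: "ideal_pow I n \<subseteq> b" and k: "\<forall>q\<in>off_primes I. \<not> b \<subseteq> q \<longrightarrow>
        loc_scale scale q (c ^ k * s) (\<gamma> q) = frac scale q (c ^ k *s m) 1"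
    unfolding P_def by (elim exE conjE)
  have rep: "represents scale I \<gamma> (c ^ k * s) (c ^ k *s m)"
    unfolding represents_def
  proof
    fix q assume q: "q \<in> off_primes I"
    obtain a where "a \<in> ideal_pow I n" "a \<notin> q" using off_primes_obtain[OF q] .
    with b have "\<not> b \<subseteq> q" by blast
    with q k show "loc_scale scale q (c ^ k * s) (\<gamma> q) = frac scale q (c ^ k *s m) 1" by simp
  qed
  \<comment> \<open>The extra factor \<open>i\<close> moves the multiplier into \<open>I\<close>, as
    \<open>represents_compatible\<close> requires.\<close>
  obtain i where i: "i \<in> I" "i \<notin> p" using p by (auto simp: off_primes_def)
  have "i * (c ^ k * s) \<notin> p"
    using i(2) c csm(1)[OF pp c] prime_ideal_power[OF pp, of c k] by (auto simp: prime_ideal_mult[OF pp])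
  moreover have "i * (c ^ k * s) \<in> I" using ideal_r_mult_right[OF I i(1)] .
  ultimately show ?thesis using represents_scale[OF \<gamma> rep] by blast
qed

text \<open>Equal fractions at all primes of D(I) force some I^m to kill the values of
  \<open>\<phi>\<close> - \<open>\<phi>'\<close> on I^k. The two maps then agree on I^k I^m =
  I^(k+m), which makes the classes equal.\<close>

lemma sect_of_inj:
  assumes "x \<in> transformD scale I" "y \<in> transformD scale I" "sect_of scale I x = sect_of scale I y"
  shows "x = y"
proof -
  obtain n \<phi> where x: "\<phi> \<in> HomI scale (ideal_pow I n)" "x = dl_class scale I n \<phi>"
    using transformD_representative[OF assms(1)] by metis
  obtain n' \<phi>' where y: "\<phi>' \<in> HomI scale (ideal_pow I n')" "y = dl_class scale I n' \<phi>'"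
    using transformD_representative[OF assms(2)] by metis
  define k where "k = max n n'"
  have sub: "a \<in> ideal_pow I n" "a \<in> ideal_pow I n'" if "a \<in> ideal_pow I k" for a
    using that ideal_pow_antimono[of n k I] ideal_pow_antimono[of n' k I] by (auto simp: k_def)
  define J where "J = {r. \<forall>a\<in>ideal_pow I k. r *s (\<phi> a - \<phi>' a) = 0}"
  have J: "ideal_r J"
    unfolding J_def by (rule ideal_rI) (simp_all add: scale_left_distrib flip: scale_scale)
  have "I \<subseteq> p" if pp: "prime_ideal_r p" "J \<subseteq> p" for p
  proof (rule ccontr)
    assume "\<not> I \<subseteq> p"
    with pp have p: "p \<in> off_primes I" by (simp add: off_primes_def)
    obtain b where b: "b \<in> ideal_pow I k" "b \<notin> p" using off_primes_obtain[OF p] .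
    have "frac scale p (\<phi> b) b = frac scale p (\<phi>' b) b"
      using assms(3) sect_of_class[OF p x(1) sub(1)[OF b(1)] b(2)]
        sect_of_class[OF p y(1) sub(2)[OF b(1)] b(2)] x(2) y(2) by simp
    then obtain u where u: "u \<notin> p" "u *s (b *s \<phi> b - b *s \<phi>' b) = 0"
      using frac_eq_iff[OF pp(1) b(2) b(2)] by blast
    \<comment> \<open>One factor \<open>b\<close> trades values at \<open>a\<close> for values at
      \<open>b\<close>, since \<open>b *s \<phi> a = a *s \<phi> b\<close>; \<open>u\<close> and the
      other \<open>b\<close> kill the resulting difference.\<close>
    have "(u * b * b) *s (\<phi> a - \<phi>' a) = 0" if a: "a \<in> ideal_pow I k" for a
    proof -
      have comm: "b *s \<phi> a = a *s \<phi> b" "b *s \<phi>' a = a *s \<phi>' b"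
        using HomI_scale[OF x(1) sub(1)[OF a], of b] HomI_scale[OF x(1) sub(1)[OF b(1)], of a]
          HomI_scale[OF y(1) sub(2)[OF a], of b] HomI_scale[OF y(1) sub(2)[OF b(1)], of a]
        by (simp_all add: mult.commute)
      have "(u * b * b) *s (\<phi> a - \<phi>' a) = (u * b) *s (b *s \<phi> a - b *s \<phi>' a)"
        by (simp add: scale_right_diff_distrib)
      also have "\<dots> = a *s (u *s (b *s \<phi> b - b *s \<phi>' b))"
        unfolding comm by (simp add: scale_right_diff_distrib mult_ac)
      finally show ?thesis by (simp only: u(2) scale_zero_right)
    qed
    then have "u * b * b \<in> p" using pp(2) by (auto simp: J_def)
    with u(1) b(2) show False by (simp add: prime_ideal_mult[OF pp(1)])
  qed
  then obtain m where m: "ideal_pow I m \<subseteq> J"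
    using ideal_pow_subset_if_primes[OF noeth I J] by blast
  define L where "L = {z \<in> ideal_pow I k. \<phi> z = \<phi>' z}"
  note ik = ideal_pow_ideal[of I k]
  have "ideal_r L"
    unfolding L_def
    by (rule ideal_rI) (use HomI_add[OF x(1)] HomI_add[OF y(1)] HomI_scale[OF x(1)] HomI_scale[OF y(1)]
        HomI_scale[OF x(1), of 0 0] HomI_scale[OF y(1), of 0 0]
        ideal_r_zero[OF ik] ideal_r_add[OF ik] ideal_r_mult[OF ik] sub in simp_all)
  moreover have "u * v \<in> L" if uv: "u \<in> ideal_pow I k" "v \<in> ideal_pow I m" for u v
  proof -
    have "v *s \<phi> u = v *s \<phi>' u" using m uv by (auto simp: J_def scale_right_diff_distrib)
    then have "\<phi> (v * u) = \<phi>' (v * u)"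
      using HomI_scale[OF x(1) sub(1)[OF uv(1)]] HomI_scale[OF y(1) sub(2)[OF uv(1)]] by simp
    then show ?thesis using ideal_r_mult[OF ik uv(1)] by (simp add: L_def mult.commute[of u v])
  qed
  ultimately have "ideal_pow I (k + m) \<subseteq> L" by (rule ideal_pow_add_subset)
  then have "\<forall>z\<in>ideal_pow I (k + m). \<phi> z = \<phi>' z" by (auto simp: L_def)
  moreover have "n \<le> k + m" "n' \<le> k + m" by (simp_all add: k_def)
  ultimately show ?thesis unfolding x(2) y(2) dl_class_eq_iff[OF x(1) y(1)] by blast
qed

text \<open>If \<open>\<psi>\<close> represents \<open>\<gamma>\<close> on an ideal \<open>b\<close> and \<open>m\<close> represents \<open>x \<gamma>\<close>, the two can disagree on
  \<open>b \<inter> (x)\<close> only by \<open>I\<close>-torsion. Since the colon ideals \<open>(b : x^k)\<close> become stationary, one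
  power of \<open>x\<close> removes the disagreement.\<close>
lemma represents_compatible:
  assumes \<gamma>: "\<gamma> \<in> sections scale I" and b: "ideal_r b" and \<psi>: "partial_hom scale b \<psi>"
    and rep: "\<And>z. z \<in> b \<Longrightarrow> represents scale I \<gamma> z (\<psi> z)"
    and x: "x \<in> I" and xm: "represents scale I \<gamma> x m"
  shows "\<exists>k. \<forall>r. r * x ^ Suc k \<in> b \<longrightarrow> \<psi> (r * x ^ Suc k) = (r * x ^ k) *s m"
proof -
  \<comment> \<open>The part of the colon ideal (b : x^(k+1)) on which the disagreement has
    vanished. The exponents differ by one because \<open>m\<close> already represents
    \<open>x \<gamma>\<close>, so \<open>x ^ Suc k\<close> is paired with
    \<open>x ^ k *s m\<close>.\<close>
  define E where "E k = {r. r * x ^ Suc k \<in> b \<and> \<psi> (r * x ^ Suc k) = (r * x ^ k) *s m}" for k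
  have mem_E: "r \<in> E k \<longleftrightarrow> r * x ^ Suc k \<in> b \<and> \<psi> (r * x ^ Suc k) = (r * x ^ k) *s m" for r k
    by (simp add: E_def)
  have E: "ideal_r (E k)" for k
  proof (rule ideal_rI)
    show "0 \<in> E k" using partial_hom_scale[OF \<psi> ideal_r_zero[OF b], of 0] ideal_r_zero[OF b]
      by (simp add: mem_E)
  next
    fix r t assume "r \<in> E k" "t \<in> E k"
    then show "r + t \<in> E k"
      using ideal_r_add[OF b] partial_hom_add[OF \<psi>]
      by (simp only: mem_E distrib_right scale_left_distrib)
  next
    fix c r assume "r \<in> E k"
    then show "c * r \<in> E k"
      using ideal_r_mult[OF b] partial_hom_scale[OF \<psi>]
      by (simp only: mem_E mult.assoc scale_scale)
  qed
  have "mono E"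
  proof (rule monoI, rule lift_Suc_mono_le)
    fix k show "E k \<subseteq> E (Suc k)"
    proof
      fix r assume "r \<in> E k"
      then have r: "r * x ^ Suc k \<in> b" "\<psi> (r * x ^ Suc k) = (r * x ^ k) *s m" by (simp_all only: mem_E)
      have eq: "r * x ^ Suc (Suc k) = x * (r * x ^ Suc k)" "r * x ^ Suc k = x * (r * x ^ k)"
        by (simp_all add: mult_ac)
      have "r * x ^ Suc (Suc k) \<in> b" unfolding eq(1) by (rule ideal_r_mult[OF b r(1)])
      moreover have "\<psi> (r * x ^ Suc (Suc k)) = (r * x ^ Suc k) *s m"
        unfolding eq(1) partial_hom_scale[OF \<psi> r(1)] r(2) scale_scale by (simp add: mult_ac)
      ultimately show "r \<in> E (Suc k)" by (simp only: mem_E)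
    qed
  qed
  then obtain k where k: "\<forall>i. E i \<subseteq> E k" using noetherian_chain[of E, OF noeth E] by blast
  \<comment> \<open>Here \<open>i\<close> is arbitrary: the disagreement at
    \<open>r * x ^ Suc i\<close> is killed by some \<open>x ^ j\<close>, so \<open>r\<close> enters
    the chain at stage \<open>i + j\<close> and lies in the stationary member \<open>E k\<close>.
    The case \<open>i = k\<close> gives the claim.\<close>
  have "r \<in> E k" if r: "r * x ^ Suc i \<in> b" for r i
  proof -
    let ?z = "r * x ^ Suc i"
    have "represents scale I \<gamma> ((r * x ^ i) * x) ((r * x ^ i) *s m)"
      by (rule represents_scale[OF \<gamma> xm])
    then have "represents scale I \<gamma> ?z ((r * x ^ i) *s m)" by (simp add: mult_ac)
    from represents_add[OF \<gamma> rep[OF r] represents_scale[OF \<gamma> this, of "- 1"]]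
    have "represents scale I \<gamma> 0 (\<psi> ?z - (r * x ^ i) *s m)" by simp
    then obtain j where j: "x ^ j *s (\<psi> ?z - (r * x ^ i) *s m) = 0"
      using represents_zero_torsion[OF \<gamma> _ x] by blast
    have eq: "r * x ^ Suc (i + j) = x ^ j * ?z" by (simp add: power_add mult_ac)
    have "\<psi> (r * x ^ Suc (i + j)) = x ^ j *s \<psi> ?z"
      unfolding eq by (rule partial_hom_scale[OF \<psi> r])
    also have "\<dots> = (r * x ^ (i + j)) *s m"
      using j by (simp add: scale_right_diff_distrib power_add mult_ac)
    finally have "r \<in> E (i + j)"
      using ideal_r_mult[OF b r, of "x ^ j"] by (simp only: mem_E eq)
    with k show ?thesis by blast
  qed
  then have "\<psi> (r * x ^ Suc k) = (r * x ^ k) *s m" if "r * x ^ Suc k \<in> b" for r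
    using that mem_E by blast
  then show ?thesis by blast
qed

text \<open>The induction enlarges an ideal \<open>b\<close> carrying a homomorphism
  \<open>\<psi>\<close> whose values \<open>\<psi> z\<close> represent \<open>z \<gamma>\<close>.
  Once \<open>b\<close> contains I^n, the class of the restriction of \<open>\<psi>\<close> to I^n
  is a preimage of \<open>\<gamma>\<close>.\<close>

lemma sect_of_surj:
  assumes \<gamma>: "\<gamma> \<in> sections scale I"
  shows "\<exists>y\<in>transformD scale I. sect_of scale I y = \<gamma>"
proof -
  define P where "P b \<longleftrightarrow> (\<exists>\<psi>. partial_hom scale b \<psi> \<and> (\<forall>z\<in>b. represents scale I \<gamma> z (\<psi> z)))" for b
  have "\<exists>b n. ideal_r b \<and> P b \<and> ideal_pow I n \<subseteq> b"
  proof (rule noetherian_cover_induct[OF noeth I])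
    have "represents scale I \<gamma> 0 0"
      unfolding represents_def
    proof
      fix p assume p: "p \<in> off_primes I"
      obtain n s where s: "s \<notin> p" "\<gamma> p = frac scale p n s" using sections_obtain[OF \<gamma> p] .
      then show "loc_scale scale p 0 (\<gamma> p) = frac scale p 0 1"
        using loc_scale_eq_iff[OF off_primes_prime[OF p] s(1), of 0 n 0] by auto
    qed
    then show "P {0}"
      unfolding P_def by (intro exI[of _ "\<lambda>_. 0"]) (simp add: partial_hom_def)
  next
    fix b p assume b: "ideal_r b" "P b" and pp: "prime_ideal_r p" "\<not> I \<subseteq> p"
    then have p: "p \<in> off_primes I" by (simp add: off_primes_def)
    obtain \<psi> where \<psi>: "partial_hom scale b \<psi>" and rep: "\<forall>z\<in>b. represents scale I \<gamma> z (\<psi> z)"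
      using b(2) unfolding P_def by (elim exE conjE)
    obtain x m where x: "x \<in> I" "x \<notin> p" and xm: "represents scale I \<gamma> x m"
      using represents_off_prime[OF \<gamma> p] by blast
    obtain k where k: "\<forall>r. r * x ^ Suc k \<in> b \<longrightarrow> \<psi> (r * x ^ Suc k) = (r * x ^ k) *s m"
      using represents_compatible[OF \<gamma> b(1) \<psi> bspec[OF rep] x(1) xm] by blast
    \<comment> \<open>Passing from \<open>x\<close> to the power \<open>x ^ Suc k\<close> makes the
      prescribed value compatible with \<open>\<psi>\<close>, and the power still lies outside
      \<open>p\<close>.\<close>
    let ?y = "x ^ Suc k" and ?m = "x ^ k *s m"
    have compat: "\<psi> (r * ?y) = r *s ?m" if "r * ?y \<in> b" for r
      using k that by (simp only: scale_scale)
    obtain \<psi>' where \<psi>': "partial_hom scale (add_principal b ?y) \<psi>'"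
      and val': "\<forall>a\<in>b. \<forall>r. \<psi>' (a + r * ?y) = \<psi> a + r *s ?m"
      by (rule partial_hom_extend[OF b(1) \<psi> compat])
    note val = val'[rule_format]
    have "represents scale I \<gamma> z (\<psi>' z)" if z: "z \<in> add_principal b ?y" for z
    proof -
      obtain a r where ar: "z = a + r * ?y" "a \<in> b" using z by (rule add_principalE)
      have "represents scale I \<gamma> (x ^ k * x) ?m" by (rule represents_scale[OF \<gamma> xm])
      then have "represents scale I \<gamma> ?y ?m" by (simp only: power_Suc2)
      then show ?thesis
        unfolding ar(1) val[OF ar(2)]
        by (intro represents_add[OF \<gamma>] represents_scale[OF \<gamma>] bspec[OF rep] ar(2))
    qed
    with \<psi>' have "P (add_principal b ?y)" unfolding P_def by blast
    moreover have "?y \<notin> p" using prime_ideal_power[OF pp(1)] x(2) by blast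
    ultimately show "\<exists>x. x \<notin> p \<and> P (add_principal b x)" by blast
  qed
  then obtain b n \<psi> where b: "ideal_pow I n \<subseteq> b" and \<psi>: "partial_hom scale b \<psi>"
    and rep: "\<forall>z\<in>b. represents scale I \<gamma> z (\<psi> z)"
    unfolding P_def by (elim exE conjE)
  let ?\<phi> = "restrict \<psi> (ideal_pow I n)"
  have H: "?\<phi> \<in> HomI scale (ideal_pow I n)"
    by (rule restrict_HomI[OF ideal_pow_ideal])
      (use b partial_hom_add[OF \<psi>] partial_hom_scale[OF \<psi>] in \<open>simp_all add: subset_iff\<close>)
  have "sect_of scale I (dl_class scale I n ?\<phi>) = \<gamma>"
  proof (rule extensionalityI[OF sect_of_extensional])
    show "\<gamma> \<in> extensional (off_primes I)" using \<gamma> by (simp add: sections_def)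
    fix p assume p: "p \<in> off_primes I"
    obtain a where a: "a \<in> ideal_pow I n" "a \<notin> p" using off_primes_obtain[OF p] .
    have "represents scale I \<gamma> a (\<psi> a)" using rep a(1) b by blast
    then show "sect_of scale I (dl_class scale I n ?\<phi>) p = \<gamma> p"
      using sect_of_class[OF p H a] represents_frac[OF \<gamma> _ p a(2)] a(1) by simp
  qed
  then show ?thesis using dl_class_in_transformD[OF H] by blast
qed

lemma sect_of_bij: "bij_betw (sect_of scale I) (transformD scale I) (sections scale I)"
  unfolding bij_betw_def
proof
  show "inj_on (sect_of scale I) (transformD scale I)" using sect_of_inj by (auto intro: inj_onI)
  show "sect_of scale I ` transformD scale I = sections scale I"
    using sect_of_in_sections sect_of_surj by (auto simp: image_iff) metis
qed

end

subsection \<open>The spectrum of a primeful module\<close>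

lemma colon_ideal:
  assumes "module sc" "module.subspace sc L"
  shows "ideal_r (colon sc L)"
proof -
  interpret module sc by fact
  show ?thesis
    using assms(2) unfolding colon_def
    by (intro ideal_rI)
      (simp_all add: scale_left_distrib subspace_0 subspace_add subspace_scale flip: scale_scale)
qed

lemma colon_prime:
  assumes "module sc" "P \<in> SpecM sc"
  shows "prime_ideal_r (colon sc P)"
proof -
  interpret module sc by fact
  have P: "subspace P" "P \<noteq> UNIV" "\<And>r m. sc r m \<in> P \<Longrightarrow> r \<in> colon sc P \<or> m \<in> P"
    using assms(2) by (auto simp: SpecM_def prime_submodule_def)
  show ?thesis
    unfolding prime_ideal_r_def
  proof (intro conjI allI impI)
    show "ideal_r (colon sc P)" by (rule colon_ideal[OF assms(1) P(1)])
    obtain m where "m \<notin> P" using P(2) by blast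
    then have "1 \<notin> colon sc P" by (auto simp: colon_def)
    then show "colon sc P \<noteq> UNIV" by blast
    fix a b assume ab: "a * b \<in> colon sc P"
    show "a \<in> colon sc P \<or> b \<in> colon sc P"
    proof (rule ccontr)
      assume neg: "\<not> (a \<in> colon sc P \<or> b \<in> colon sc P)"
      then obtain m where "sc b m \<notin> P" by (auto simp: colon_def)
      moreover have "sc a (sc b m) \<in> P" using ab by (simp add: colon_def)
      ultimately show False using P(3) neg by blast
    qed
  qed
qed

text \<open>Faithfulness puts Ann(M) = 0 inside every prime and rules out M = 0, where 1 would
  annihilate; so primefulness reaches every prime of R.\<close>

lemma primeful_obtain:
  fixes sc :: "'r::comm_ring_1 \<Rightarrow> 'm::ab_group_add \<Rightarrow> 'm"
  assumes "module sc" "faithful sc" "primeful sc" "prime_ideal_r p"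
  obtains P where "P \<in> SpecM sc" "colon sc P = p"
proof -
  interpret module sc by fact
  have Ann: "Ann sc = {0}" using assms(2) by (simp add: faithful_def)
  have "(UNIV :: 'm set) \<noteq> {0}"
  proof
    assume *: "(UNIV :: 'm set) = {0}"
    have "m = 0" for m :: 'm using UNIV_I[of m] unfolding * by blast
    then have "1 \<in> Ann sc" unfolding Ann_def by blast
    with Ann show False by simp
  qed
  moreover have "Ann sc \<subseteq> p" using assms(4) by (simp add: Ann prime_ideal_r_def ideal_r_zero)
  ultimately show thesis using assms(3,4) that unfolding primeful_def by blast
qed

lemma Supp_complement:
  assumes "module sc" "faithful sc" "primeful sc"
  shows "Supp sc (SpecM sc - VM sc K) = off_primes (colon sc K)"
proof
  show "Supp sc (SpecM sc - VM sc K) \<subseteq> off_primes (colon sc K)"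
    using colon_prime[OF assms(1)] by (auto simp: Supp_def VM_def off_primes_def)
  show "off_primes (colon sc K) \<subseteq> Supp sc (SpecM sc - VM sc K)"
  proof
    fix p assume p: "p \<in> off_primes (colon sc K)"
    obtain P where P: "P \<in> SpecM sc" "colon sc P = p"
      using primeful_obtain[OF assms off_primes_prime[OF p]] .
    with p have "P \<in> SpecM sc - VM sc K" by (simp add: VM_def off_primes_def)
    with P(2) show "p \<in> Supp sc (SpecM sc - VM sc K)" unfolding Supp_def by blast
  qed
qed

text \<open>The topology of Spec(M) is pulled back from Spec(R) along P \<mapsto> (P:M), whose image
  is all of Spec(R). Hence neighbourhoods in Spec(M) may be shrunk to preimages of basic open sets
  D(c).\<close>

lemma sheafA_eq_sections:
  assumes M: "module scM" "faithful scM" "primeful scM"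
  shows "sheafA scN scM (SpecM scM - VM scM K) = sections scN (colon scM K)"
proof (rule set_eqI, rule iffI)
  interpret module scM by fact
  note Supp = Supp_complement[OF M, of K]
  let ?U = "SpecM scM - VM scM K" and ?I = "colon scM K"
  {
    fix \<gamma> assume g: "\<gamma> \<in> sheafA scN scM ?U"
    have "\<exists>c s m. c \<notin> p \<and> (\<forall>q. prime_ideal_r q \<and> c \<notin> q \<longrightarrow>
        q \<in> off_primes ?I \<and> s \<notin> q \<and> \<gamma> q = frac scN q m s)" if p: "p \<in> off_primes ?I" for p
    proof -
      obtain Q where Q: "Q \<in> ?U" "colon scM Q = p" using p unfolding Supp[symmetric] Supp_def by blast
      have "\<exists>W. zariski_open scM W \<and> Q \<in> W \<and> W \<subseteq> ?U \<and>
        (\<exists>s m. \<forall>P\<in>W. s \<notin> colon scM P \<and> \<gamma> (colon scM P) = frac scN (colon scM P) m s)"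
        using g Q(1) by (simp add: sheafA_def)
      then obtain W s m where W: "zariski_open scM W" "Q \<in> W" "W \<subseteq> ?U"
        and loc: "\<forall>P\<in>W. s \<notin> colon scM P \<and> \<gamma> (colon scM P) = frac scN (colon scM P) m s"
        by (elim exE conjE)
      obtain L where L: "W = SpecM scM - VM scM L" using W(1) unfolding zariski_open_def by blast
      \<comment> \<open>Every \<open>P\<close> with (P:M) in D(c) avoids V(L), so the preimage of
        D(c) is contained in \<open>W\<close>.\<close>
      obtain c where c: "c \<in> colon scM L" "c \<notin> p" using W(2) Q(2) by (auto simp: L VM_def)
      have "q \<in> off_primes ?I \<and> s \<notin> q \<and> \<gamma> q = frac scN q m s" if q: "prime_ideal_r q" "c \<notin> q" for q
      proof -
        obtain P where P: "P \<in> SpecM scM" "colon scM P = q" using primeful_obtain[OF M q(1)] .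
        then have "P \<in> W" using c(1) q(2) by (auto simp: L VM_def)
        moreover from this have "q \<in> off_primes ?I"
          using W(3) P(2) unfolding Supp[symmetric] Supp_def by blast
        ultimately show ?thesis using loc P(2) by auto
      qed
      with c(2) show ?thesis by blast
    qed
    then show "\<gamma> \<in> sections scN ?I" using g by (simp add: sections_def sheafA_def Supp)
  next
    fix \<gamma> assume g: "\<gamma> \<in> sections scN ?I"
    have "\<gamma> p \<in> localization scN p" if p: "p \<in> off_primes ?I" for p
    proof -
      obtain n s where "s \<notin> p" "\<gamma> p = frac scN p n s" using sections_obtain[OF g p] .
      then show ?thesis unfolding localization_def by blast
    qed
    moreover have "\<exists>W. zariski_open scM W \<and> Q \<in> W \<and> W \<subseteq> ?U \<and>
        (\<exists>s m. \<forall>P\<in>W. s \<notin> colon scM P \<and> \<gamma> (colon scM P) = frac scN (colon scM P) m s)"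
      if Q: "Q \<in> ?U" for Q
    proof -
      have "colon scM Q \<in> off_primes ?I" using Q unfolding Supp[symmetric] Supp_def by blast
      then obtain c s m where c: "c \<notin> colon scM Q" and loc: "\<forall>q. prime_ideal_r q \<and> c \<notin> q \<longrightarrow>
          q \<in> off_primes ?I \<and> s \<notin> q \<and> \<gamma> q = frac scN q m s"
        by (rule sections_local[OF g])
      \<comment> \<open>The submodule cM; the complement of V(cM) is the preimage of D(c).\<close>
      define L where "L = range (scM c)"
      define W where "W = SpecM scM - VM scM L"
      have "subspace L"
      proof (rule subspaceI)
        show "0 \<in> L" unfolding L_def by (rule range_eqI[of _ _ 0]) simp
        fix x y assume "x \<in> L" "y \<in> L"
        then obtain u v where "x = scM c u" "y = scM c v" unfolding L_def by blast
        then have "x + y = scM c (u + v)" by (simp add: scale_right_distrib)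
        then show "x + y \<in> L" unfolding L_def by blast
      next
        fix r x assume "x \<in> L"
        then obtain u where "x = scM c u" unfolding L_def by blast
        then have "scM r x = scM c (scM r u)" by (simp add: mult.commute)
        then show "scM r x \<in> L" unfolding L_def by blast
      qed
      then have "zariski_open scM W" unfolding zariski_open_def W_def by blast
      have mem_W: "P \<in> W \<longleftrightarrow> c \<notin> colon scM P" if P: "P \<in> SpecM scM" for P
      proof -
        have "subspace P" using P by (simp add: SpecM_def prime_submodule_def)
        have "c \<in> colon scM L" by (simp add: colon_def L_def)
        moreover have "colon scM L \<subseteq> colon scM P" if "c \<in> colon scM P"
        proof -
          have "L \<subseteq> P" using that by (auto simp: colon_def L_def)
          then show ?thesis unfolding colon_def by blast
        qed
        ultimately show ?thesis using P by (auto simp: W_def VM_def)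
      qed
      have good: "P \<in> ?U \<and> s \<notin> colon scM P \<and> \<gamma> (colon scM P) = frac scN (colon scM P) m s"
        if P: "P \<in> W" for P
      proof -
        have PS: "P \<in> SpecM scM" using P by (simp add: W_def)
        have "prime_ideal_r (colon scM P)" "c \<notin> colon scM P"
          using colon_prime[OF M(1) PS] mem_W[OF PS] P by simp_all
        with loc have "colon scM P \<in> off_primes ?I" "s \<notin> colon scM P"
          "\<gamma> (colon scM P) = frac scN (colon scM P) m s" by simp_all
        then show ?thesis using PS by (simp add: VM_def off_primes_def)
      qed
      have "Q \<in> W" using Q mem_W c by blast
      with \<open>zariski_open scM W\<close> good show ?thesis by blast
    qed
    ultimately show "\<gamma> \<in> sheafA scN scM ?U"
      using g unfolding sheafA_def Supp by (simp add: sections_def)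
  }
qed

section \<open>Existence, uniqueness and naturality of the isomorphism\<close>

locale primeful_setting = noetherian_module scale "colon scM K"
  for scale :: "'r::comm_ring_1 \<Rightarrow> 'n::ab_group_add \<Rightarrow> 'n" (infixr \<open>*s\<close> 75)
    and scM :: "'r \<Rightarrow> 'm::ab_group_add \<Rightarrow> 'm" and K :: "'m set" +
  assumes M: "module scM" "faithful scM" "primeful scM"
begin

abbreviation "U \<equiv> SpecM scM - VM scM K"
abbreviation "T \<equiv> transformD scale (colon scM K)"
abbreviation "G \<equiv> sect_of scale (colon scM K)"

lemmas Supp_U = Supp_complement[OF M, of K]
lemmas sheafA_U = sheafA_eq_sections[OF M, of scale K]

lemma G_bij: "bij_betw G T (sheafA scale scM U)"
  unfolding sheafA_U by (rule sect_of_bij)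

lemma G_eta: "G (etaD scale (colon scM K) n) = epsilonA scale scM U n"
  by (simp add: sect_of_etaD epsilonA_def Supp_U)

lemma G_add: "x \<in> T \<Longrightarrow> y \<in> T \<Longrightarrow>
    G (transformD_add scale (colon scM K) x y) = sheafA_add scale scM U (G x) (G y)"
  by (simp add: sect_of_add sheafA_add_def Supp_U)

lemma G_scale: "x \<in> T \<Longrightarrow>
    G (transformD_scale scale (colon scM K) r x) = sheafA_scale scale scM U r (G x)"
  by (simp add: sect_of_scale sheafA_scale_def Supp_U)

text \<open>The inverse of a bijection that respects addition, scaling and the canonical maps
  respects them too. The restriction provides the extensionality that makes uniqueness meaningful
  for total functions.\<close>

lemma is_fKN_inverse: "is_fKN scale scM K (restrict (inv_into T G) (sheafA scale scM U))"
proof -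
  let ?F = "inv_into T G" and ?A = "sheafA scale scM U"
  have F: "?F \<gamma> \<in> T" "G (?F \<gamma>) = \<gamma>" if "\<gamma> \<in> ?A" for \<gamma>
    using that G_bij by (auto simp: bij_betw_def inv_into_into f_inv_into_f)
  have FG: "?F (G x) = x" if "x \<in> T" for x
    using that G_bij by (simp add: bij_betw_def)
  have GA: "G x \<in> ?A" if "x \<in> T" for x using that G_bij by (auto simp: bij_betw_def)
  have "bij_betw (restrict ?F ?A) ?A T"
    using bij_betw_inv_into[OF G_bij] by (simp add: bij_betw_def inj_on_restrict_eq)
  moreover have "restrict ?F ?A (sheafA_add scale scM U \<gamma> \<delta>)
      = transformD_add scale (colon scM K) (restrict ?F ?A \<gamma>) (restrict ?F ?A \<delta>)"
    if "\<gamma> \<in> ?A" "\<delta> \<in> ?A" for \<gamma> \<delta>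
  proof -
    have T: "transformD_add scale (colon scM K) (?F \<gamma>) (?F \<delta>) \<in> T"
      using F that by (intro sect_of_add) auto
    show ?thesis using FG[OF T] GA[OF T] G_add[of "?F \<gamma>" "?F \<delta>"] F that by simp
  qed
  moreover have "restrict ?F ?A (sheafA_scale scale scM U r \<gamma>)
      = transformD_scale scale (colon scM K) r (restrict ?F ?A \<gamma>)"
    if "\<gamma> \<in> ?A" for r \<gamma>
  proof -
    have T: "transformD_scale scale (colon scM K) r (?F \<gamma>) \<in> T"
      using F that by (intro sect_of_scale) auto
    show ?thesis using FG[OF T] GA[OF T] G_scale[of "?F \<gamma>" r] F that by simp
  qed
  moreover have "restrict ?F ?A (epsilonA scale scM U n) = etaD scale (colon scM K) n" for n
    using FG[OF etaD_in] GA[OF etaD_in] by (simp add: G_eta)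
  ultimately show ?thesis by (simp add: is_fKN_def Let_def)
qed

text \<open>A section \<open>\<gamma>\<close> is determined by the multiples \<open>x \<gamma>\<close> that come from the module, since near each
  prime some such \<open>x\<close> is invertible.\<close>
lemma is_fKN_left_inverse:
  assumes f: "is_fKN scale scM K f" and \<gamma>: "\<gamma> \<in> sheafA scale scM U"
  shows "f \<gamma> \<in> T" and "G (f \<gamma>) = \<gamma>"
proof -
  show fT: "f \<gamma> \<in> T" using f \<gamma> by (auto simp: is_fKN_def Let_def bij_betw_def)
  have Gf: "G (f \<gamma>) \<in> sections scale (colon scM K)" by (rule sect_of_in_sections[OF fT])
  have \<gamma>': "\<gamma> \<in> sections scale (colon scM K)" using \<gamma> by (simp add: sheafA_U)
  show "G (f \<gamma>) = \<gamma>"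
  proof (rule extensionalityI[OF sect_of_extensional])
    show "\<gamma> \<in> extensional (off_primes (colon scM K))" using \<gamma>' by (simp add: sections_def)
    fix p assume p: "p \<in> off_primes (colon scM K)"
    obtain x m where x: "x \<notin> p" and xm: "represents scale (colon scM K) \<gamma> x m"
      using represents_off_prime[OF \<gamma>' p] by blast
    have eps: "sheafA_scale scale scM U x \<gamma> = epsilonA scale scM U m"
      using xm by (auto simp: represents_def sheafA_scale_def epsilonA_def Supp_U intro!: restrict_ext)
    \<comment> \<open>Linearity of \<open>f\<close> and its compatibility with \<epsilon> show that
      \<open>m\<close> also represents \<open>x\<close> times \<open>G (f \<gamma>)\<close>; both
      sections therefore have the value m/x at \<open>p\<close>.\<close>
    have "sheafA_scale scale scM U x (G (f \<gamma>)) = G (transformD_scale scale (colon scM K) x (f \<gamma>))"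
      by (rule G_scale[OF fT, symmetric])
    also have "\<dots> = G (f (sheafA_scale scale scM U x \<gamma>))"
      using f \<gamma> by (simp add: is_fKN_def Let_def)
    also have "\<dots> = G (f (epsilonA scale scM U m))" by (simp only: eps)
    also have "\<dots> = epsilonA scale scM U m"
      using f by (simp add: is_fKN_def Let_def G_eta)
    finally have eq: "sheafA_scale scale scM U x (G (f \<gamma>)) = epsilonA scale scM U m" .
    have "represents scale (colon scM K) (G (f \<gamma>)) x m"
      unfolding represents_def
    proof
      fix q assume "q \<in> off_primes (colon scM K)"
      then show "loc_scale scale q x (G (f \<gamma>) q) = frac scale q m 1"
        using fun_cong[OF eq, of q] by (simp add: sheafA_scale_def epsilonA_def Supp_U)
    qed
    then show "G (f \<gamma>) p = \<gamma> p"
      using represents_frac[OF Gf _ p x] represents_frac[OF \<gamma>' xm p x] by simp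
  qed
qed

text \<open>Any admissible \<open>f\<close> satisfies \<open>G (f \<gamma>) = \<gamma>\<close>, and
  \<open>G\<close> is injective on \<open>T\<close>.\<close>

lemma ex1_is_fKN: "\<exists>!f. is_fKN scale scM K f"
proof (rule ex_ex1I)
  show "\<exists>f. is_fKN scale scM K f" using is_fKN_inverse by blast
  fix f g assume f: "is_fKN scale scM K f" and g: "is_fKN scale scM K g"
  show "f = g"
  proof (rule extensionalityI)
    show "f \<in> extensional (sheafA scale scM U)" "g \<in> extensional (sheafA scale scM U)"
      using f g by (simp_all add: is_fKN_def Let_def)
    fix \<gamma> assume "\<gamma> \<in> sheafA scale scM U"
    then show "f \<gamma> = g \<gamma>"
      using is_fKN_left_inverse[OF f] is_fKN_left_inverse[OF g] by (metis sect_of_inj)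
  qed
qed

end

theorem theorem3p13:
  fixes scM :: "'r::comm_ring_1 \<Rightarrow> 'm::ab_group_add \<Rightarrow> 'm"
    and scN :: "'r \<Rightarrow> 'n::ab_group_add \<Rightarrow> 'n"
    and scL :: "'r \<Rightarrow> 'l::ab_group_add \<Rightarrow> 'l"
    and K :: "'m set"
  assumes "noetherian_ring TYPE('r)"
    and "module scM" and "faithful scM" and "primeful scM"
    and "module.subspace scM K"
    and "module scN" and "module scL"
  shows "(\<exists>!f. is_fKN scN scM K f) \<and> (\<exists>!f. is_fKN scL scM K f) \<and>
    (\<forall>h fL fN. module_hom scL scN h \<and> is_fKN scL scM K fL \<and> is_fKN scN scM K fN \<longrightarrow>
       (\<forall>\<gamma>\<in>sheafA scL scM (SpecM scM - VM scM K).
          fN (sheafA_map scN scM (SpecM scM - VM scM K) h \<gamma>)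
          = transformD_map scN (colon scM K) h (fL \<gamma>)))"
proof -
  note I = colon_ideal[OF assms(2,5)]
  interpret N: primeful_setting scN scM K
    by (intro primeful_setting.intro noetherian_module.intro noetherian_module_axioms.intro
        primeful_setting_axioms.intro assms I)
  interpret L: primeful_setting scL scM K
    by (intro primeful_setting.intro noetherian_module.intro noetherian_module_axioms.intro
        primeful_setting_axioms.intro assms I)
  have "fN (sheafA_map scN scM (SpecM scM - VM scM K) h \<gamma>) = transformD_map scN (colon scM K) h (fL \<gamma>)"
    if h: "module_hom scL scN h" and fL: "is_fKN scL scM K fL" and fN: "is_fKN scN scM K fN"
      and \<gamma>: "\<gamma> \<in> sheafA scL scM (SpecM scM - VM scM K)" for h fL fN \<gamma>
  proof -
    note T = L.is_fKN_left_inverse(1)[OF fL \<gamma>]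
    \<comment> \<open>Naturality is first obtained for the maps \<open>G\<close>, where it is a
      computation with fractions; applying \<open>fN\<close> and cancelling the injective
      \<open>N.G\<close> transfers it.\<close>
    have map: "sheafA_map scN scM (SpecM scM - VM scM K) h \<gamma> = N.G (transformD_map scN (colon scM K) h (fL \<gamma>))"
      unfolding sect_of_map(1)[OF h T] L.is_fKN_left_inverse(2)[OF fL \<gamma>]
      by (simp add: sheafA_map_def N.Supp_U)
    note mem = sect_of_map(2)[OF h T]
    have "sheafA_map scN scM (SpecM scM - VM scM K) h \<gamma> \<in> sheafA scN scM (SpecM scM - VM scM K)"
      unfolding map N.sheafA_U by (rule N.sect_of_in_sections[OF mem])
    from N.is_fKN_left_inverse[OF fN this] show ?thesis
      using N.sect_of_inj[OF _ mem] map by simp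
  qed
  then show ?thesis using N.ex1_is_fKN L.ex1_is_fKN by blast
qed

end
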